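(* Assume that $f:[0,\infty)\to[0,\infty)$ is a nondecreasing $C^1$ function with $f(0)=0$, and that $u$ is a nonnegative classical solution to the problem $$ \begin{cases} \Delta u=0 & \text{in }\mathbb{R}^{2}_{++},\\ u(x,y)\ge 0 & \text{in }\mathbb{R}^{2}_{++},\\ u(0,y)=0 & \text{on }\{x=0,\ y\ge 0\},\\ \dfrac{\partial u}{\partial \nu}=f(u) & \text{on }\{x>0,\ y=0\}. \end{cases} $$ Then there exists a constant $C\ge 0$ such that $u(x,y)=Cx$ for all $(x,y)\in\mathbb{R}^2_{++}$.
   Context: $\mathbb{R}^2_{++}=\{(x,y)\in\mathbb{R}^2: x>0,\ y>0\}$, and $\nu$ is the unit outward normal to $\mathbb{R}^2_{++}$ at $\{x>0,\ y=0\}$, so that $\frac{\partial u}{\partial\nu}=-\frac{\partial u}{\partial y}$ there. A classical solution is a function $u\in C^2(\mathbb{R}^{2}_{++})\cap C^1(\overline{\mathbb{R}^{2}_{++}})$ satisfying all the conditions pointwise. *)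

theory Defs
  imports "HOL-Analysis.Analysis"
begin

definition quarter_plane :: "(real \<times> real) set" where
  "quarter_plane = {(x, y). x > 0 \<and> y > 0}"

definition partial_x :: "(real \<times> real \<Rightarrow> real) \<Rightarrow> real \<times> real \<Rightarrow> real" where
  "partial_x u = (\<lambda>(x, y). deriv (\<lambda>s. u (s, y)) x)"

definition partial_y :: "(real \<times> real \<Rightarrow> real) \<Rightarrow> real \<times> real \<Rightarrow> real" where
  "partial_y u = (\<lambda>(x, y). deriv (\<lambda>t. u (x, t)) y)"

definition laplacian :: "(real \<times> real \<Rightarrow> real) \<Rightarrow> real \<times> real \<Rightarrow> real" where
  "laplacian u p = partial_x (partial_x u) p + partial_y (partial_y u) p"

text \<open>The space \<open>C\<^sup>k(S)\<close> for an open set \<open>S\<close>: all partial derivatives up to order \<open>k\<close>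
  exist in \<open>S\<close> and are continuous there. The existence clauses are needed since \<^const>\<open>deriv\<close>
  is total.\<close>

primrec Ck_on :: "nat \<Rightarrow> (real \<times> real) set \<Rightarrow> (real \<times> real \<Rightarrow> real) \<Rightarrow> bool" where
  "Ck_on 0 S u \<longleftrightarrow> continuous_on S u"
| "Ck_on (Suc k) S u \<longleftrightarrow>
     continuous_on S u \<and>
     (\<forall>(x, y)\<in>S. (\<lambda>s. u (s, y)) field_differentiable (at x) \<and>
                 (\<lambda>t. u (x, t)) field_differentiable (at y)) \<and>
     Ck_on k S (partial_x u) \<and> Ck_on k S (partial_y u)"

text \<open>The space \<open>C\<^sup>1\<close> up to the boundary of an open set \<open>S\<close>: \<open>u\<close> is continuous on the closure
  and its first partial derivatives in \<open>S\<close> extend continuously to the closure. The values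
  of \<open>partial_x u\<close> and \<open>partial_y u\<close> at boundary points, which involve two-sided derivatives,
  are not referred to.\<close>

definition C1_on_closure :: "(real \<times> real) set \<Rightarrow> (real \<times> real \<Rightarrow> real) \<Rightarrow> bool" where
  "C1_on_closure S u \<longleftrightarrow>
     Ck_on 1 S u \<and> continuous_on (closure S) u \<and>
     (\<exists>v. continuous_on (closure S) v \<and> (\<forall>p\<in>S. v p = partial_x u p)) \<and>
     (\<exists>w. continuous_on (closure S) w \<and> (\<forall>p\<in>S. w p = partial_y u p))"

text \<open>At a point \<open>(x, 0)\<close> with \<open>x > 0\<close> the outward unit normal to the quarter plane is
  \<open>(0, -1)\<close>, so the normal derivative is minus the one-sided \<open>y\<close>-derivative.\<close>

definition has_normal_derivative_at_bottom ::
    "(real \<times> real \<Rightarrow> real) \<Rightarrow> real \<Rightarrow> real \<Rightarrow> bool" where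
  "has_normal_derivative_at_bottom u d x \<longleftrightarrow>
     ((\<lambda>y. u (x, y)) has_real_derivative (- d)) (at 0 within {0..})"

text \<open>\<open>C\<^sup>1([0,\<infinity>))\<close>, with a one-sided derivative at \<open>0\<close>.\<close>

definition C1_half_line :: "(real \<Rightarrow> real) \<Rightarrow> bool" where
  "C1_half_line f \<longleftrightarrow>
     (\<exists>f'. (\<forall>t\<ge>0. (f has_real_derivative f' t) (at t within {0..})) \<and> continuous_on {0..} f')"

text \<open>Only the values of \<open>u\<close> on the closed quarter plane and those of \<open>f\<close> on \<open>[0,\<infinity>)\<close> matter.\<close>

definition nonneg_classical_solution :: "(real \<Rightarrow> real) \<Rightarrow> (real \<times> real \<Rightarrow> real) \<Rightarrow> bool" where
  "nonneg_classical_solution f u \<longleftrightarrow>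
     Ck_on 2 quarter_plane u \<and> C1_on_closure quarter_plane u \<and>
     (\<forall>p\<in>quarter_plane. laplacian u p = 0) \<and>
     (\<forall>p\<in>quarter_plane. u p \<ge> 0) \<and>
     (\<forall>y\<ge>0. u (0, y) = 0) \<and>
     (\<forall>x>0. has_normal_derivative_at_bottom u (f (u (x, 0))) x)"

end

theory Submission
  imports Defs "HOL-Complex_Analysis.Complex_Analysis" "HOL-Real_Asymp.Real_Asymp"
begin

text \<open>
  The boundary flux \<open>g t = f (u (t, 0))\<close> is nonnegative, so the even reflection of \<open>u\<close> in the \<open>x\<close>-axis is a
  nonnegative superharmonic function in the half-plane \<open>x > 0\<close> that vanishes on its boundary. Such a
  function is a multiple of \<open>x\<close> plus the Green potential of its sources:
  \<open>2 * pi * u (x, y) = q * x + (\<integral>t\<ge>0. green_log x y t * g t)\<close> with \<open>q \<ge> 0\<close> (\<open>green_representation\<close>).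
  It remains to see that \<open>g = 0\<close>.

  Suppose that \<open>g\<close> is positive somewhere. The potential formula allows the method of moving planes: for
  the reflection \<open>t \<mapsto> 2 * \<mu> - t\<close> of the boundary, the difference \<open>u (2 * \<mu> - x, y) - u (x, y)\<close> is bounded below
  by an integral of \<open>g (2 * \<mu> - t) - g t\<close> with a positive kernel (\<open>reflected_difference\<close>). Since \<open>f\<close> is
  nondecreasing and locally Lipschitz, this gives \<open>u (x, 0) \<le> u (2 * \<mu> - x, 0)\<close> for \<open>0 \<le> x \<le> \<mu>\<close>,
  for small \<open>\<mu>\<close> at first and then for all \<open>\<mu>\<close> (\<open>reflection_inequality\<close>). Hence \<open>u (\<cdot>, 0)\<close> is
  nondecreasing, and so is \<open>g\<close>. Now \<open>g\<close> is bounded below by a positive constant near infinity, whereas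
  \<open>green_log x y t\<close> decays like \<open>1 / t\<close>: the potential is infinite, a contradiction (\<open>flux_zero\<close>).

  The representation formula is derived from Cauchy's formula. The complex gradient
  \<open>u\<^sub>x - \<i> u\<^sub>y\<close> is holomorphic and continuous up to the boundary, so it has a primitive \<open>\<Phi>\<close>, with
  \<open>Re \<Phi> = u\<close>, and the derivative of \<open>Im \<Phi>\<close> along the positive real axis is \<open>g\<close> (\<open>holomorphic_completion\<close>).
  Cauchy's formula for \<open>\<Phi>\<close> times a rational kernel in a quarter disc of radius \<open>R\<close> is Green's formula for
  \<open>u\<close>. On the arc the kernel is, up to a factor that tends to a constant, a function of \<open>R\<close> and the angle
  times \<open>x\<close>. Together with \<open>u \<ge> 0\<close> this gives the limit \<open>R \<rightarrow> \<infinity>\<close> without any assumption on the growth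
  of \<open>u\<close>.
\<close>

section \<open>The complex gradient of a harmonic function\<close>

text \<open>Two applications of the mean value theorem turn the second-order difference of \<open>u\<close> over the
  square with corner \<open>(a, b)\<close> and side \<open>h\<close> into \<open>h\<^sup>2\<close> times a mixed derivative at some point of
  the square. The difference is symmetric in the two variables, so this gives the equality of mixed
  partial derivatives.\<close>

lemma mixed_difference_quotient_tendsto:
  fixes u ux uxy :: "real \<times> real \<Rightarrow> real"
  assumes r: "r > 0"
    and ux: "\<And>x y. \<bar>x - a\<bar> < r \<Longrightarrow> \<bar>y - b\<bar> < r \<Longrightarrow>
               ((\<lambda>s. u (s, y)) has_real_derivative ux (x, y)) (at x)"
    and uxy: "\<And>x y. \<bar>x - a\<bar> < r \<Longrightarrow> \<bar>y - b\<bar> < r \<Longrightarrow>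
               ((\<lambda>t. ux (x, t)) has_real_derivative uxy (x, y)) (at y)"
    and cont: "isCont uxy (a, b)"
  shows "((\<lambda>h. (u (a + h, b + h) - u (a + h, b) - u (a, b + h) + u (a, b)) / h\<^sup>2)
           \<longlongrightarrow> uxy (a, b)) (at_right 0)"
proof (rule tendstoI)
  fix e :: real assume "e > 0"
  then obtain d where d: "d > 0" "\<And>p. dist p (a, b) < d \<Longrightarrow> dist (uxy p) (uxy (a, b)) < e"
    using cont unfolding continuous_at_eps_delta by blast
  have "dist ((u (a + h, b + h) - u (a + h, b) - u (a, b + h) + u (a, b)) / h\<^sup>2) (uxy (a, b)) < e"
    if h: "0 < h" "h < min r (d / 2)" for h
  proof -
    have "\<exists>\<xi>>a. \<xi> < a + h \<and> (u (a + h, b + h) - u (a + h, b)) - (u (a, b + h) - u (a, b))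
             = (a + h - a) * (ux (\<xi>, b + h) - ux (\<xi>, b))"
      using h by (intro MVT2 DERIV_diff ux) auto
    then obtain \<xi> where \<xi>: "a < \<xi>" "\<xi> < a + h"
      "(u (a + h, b + h) - u (a + h, b)) - (u (a, b + h) - u (a, b)) = h * (ux (\<xi>, b + h) - ux (\<xi>, b))"
      by auto
    have "\<exists>\<eta>>b. \<eta> < b + h \<and> ux (\<xi>, b + h) - ux (\<xi>, b) = (b + h - b) * uxy (\<xi>, \<eta>)"
      using h \<xi> by (intro MVT2 uxy) auto
    then obtain \<eta> where \<eta>: "b < \<eta>" "\<eta> < b + h" "ux (\<xi>, b + h) - ux (\<xi>, b) = h * uxy (\<xi>, \<eta>)"
      by auto
    have "dist (\<xi>, \<eta>) (a, b) \<le> \<bar>\<xi> - a\<bar> + \<bar>\<eta> - b\<bar>"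
      unfolding dist_Pair_Pair dist_real_def by (intro sqrt_sum_squares_le_sum) auto
    also have "\<dots> < d" using \<xi> \<eta> h by auto
    finally have "dist (uxy (\<xi>, \<eta>)) (uxy (a, b)) < e" by (rule d)
    moreover have "(u (a + h, b + h) - u (a + h, b) - u (a, b + h) + u (a, b)) / h\<^sup>2 = uxy (\<xi>, \<eta>)"
      using \<xi> \<eta> h by (simp add: field_simps power2_eq_square)
    ultimately show ?thesis by simp
  qed
  then show "\<forall>\<^sub>F h in at_right 0. dist ((u (a + h, b + h) - u (a + h, b) - u (a, b + h) + u (a, b)) / h\<^sup>2)
                (uxy (a, b)) < e"
    using r d(1) by (auto simp: eventually_at_right_field intro!: exI[of _ "min r (d / 2)"])
qed

lemma open_quarter_plane: "open quarter_plane"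
  and quarter_plane_eq_Times: "quarter_plane = {0<..} \<times> {0<..}"
proof -
  show *: "quarter_plane = {0<..} \<times> {0<..}" by (auto simp: quarter_plane_def)
  show "open quarter_plane" unfolding * by (intro open_Times) auto
qed

lemma closure_quarter_plane: "closure quarter_plane = {0..} \<times> {0..}"
  unfolding quarter_plane_eq_Times closure_Times by simp

lemma partial_x_has_derivative:
  assumes "Ck_on (Suc k) S u" "(x, y) \<in> S"
  shows "((\<lambda>s. u (s, y)) has_real_derivative partial_x u (x, y)) (at x)"
  using assms by (auto simp: partial_x_def DERIV_deriv_iff_field_differentiable)

lemma partial_y_has_derivative:
  assumes "Ck_on (Suc k) S u" "(x, y) \<in> S"
  shows "((\<lambda>t. u (x, t)) has_real_derivative partial_y u (x, y)) (at y)"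
  using assms by (auto simp: partial_y_def DERIV_deriv_iff_field_differentiable)

lemma mixed_partials_eq:
  assumes u: "Ck_on 2 quarter_plane u" and p: "p \<in> quarter_plane"
  shows "partial_y (partial_x u) p = partial_x (partial_y u) p"
proof -
  obtain a b where ab: "p = (a, b)" "a > 0" "b > 0" using p by (auto simp: quarter_plane_def)
  define r where "r = min a b"
  have r: "r > 0" "\<And>x y. \<bar>x - a\<bar> < r \<Longrightarrow> \<bar>y - b\<bar> < r \<Longrightarrow> (x, y) \<in> quarter_plane"
    using ab by (auto simp: r_def quarter_plane_def)
  have u2: "Ck_on (Suc (Suc 0)) quarter_plane u" using u by (simp add: numeral_2_eq_2)
  then have u1: "Ck_on (Suc 0) quarter_plane (partial_x u)" "Ck_on (Suc 0) quarter_plane (partial_y u)"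
    by simp_all
  have cont: "isCont (partial_y (partial_x u)) (a, b)" "isCont (partial_x (partial_y u)) (a, b)"
    using u1 p open_quarter_plane unfolding ab by (auto simp: continuous_on_eq_continuous_at)
  have 1: "((\<lambda>h. (u (a + h, b + h) - u (a + h, b) - u (a, b + h) + u (a, b)) / h\<^sup>2)
           \<longlongrightarrow> partial_y (partial_x u) (a, b)) (at_right 0)"
    using r cont by (intro mixed_difference_quotient_tendsto[of r])
      (auto intro!: partial_x_has_derivative[OF u2] partial_y_has_derivative[OF u1(1)])
  have "((\<lambda>h. ((u \<circ> prod.swap) (b + h, a + h) - (u \<circ> prod.swap) (b + h, a)
             - (u \<circ> prod.swap) (b, a + h) + (u \<circ> prod.swap) (b, a)) / h\<^sup>2)
           \<longlongrightarrow> (partial_x (partial_y u) \<circ> prod.swap) (b, a)) (at_right 0)"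
  proof (rule mixed_difference_quotient_tendsto[of r _ _ _ "partial_y u \<circ> prod.swap"])
    show "isCont (partial_x (partial_y u) \<circ> prod.swap) (b, a)"
      using cont(2) unfolding prod.swap_def[abs_def]
      by (intro continuous_at_compose) (auto intro!: continuous_intros)
  qed (use r in \<open>auto intro!: partial_y_has_derivative[OF u2] partial_x_has_derivative[OF u1(2)]\<close>)
  then have 2: "((\<lambda>h. (u (a + h, b + h) - u (a + h, b) - u (a, b + h) + u (a, b)) / h\<^sup>2)
           \<longlongrightarrow> partial_x (partial_y u) (a, b)) (at_right 0)"
    by (simp add: algebra_simps)
  show ?thesis unfolding ab using tendsto_unique[OF _ 1 2] by simp
qed

lemma Ck_on_1_has_derivative:
  assumes w: "Ck_on (Suc 0) quarter_plane w" and p: "p \<in> quarter_plane"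
  shows "(w has_derivative (\<lambda>h. partial_x w p * fst h + partial_y w p * snd h)) (at p)"
proof -
  obtain x y where xy: "p = (x, y)" "x > 0" "y > 0" using p by (auto simp: quarter_plane_def)
  let ?P = "{0<..} :: real set"
  let ?fy = "\<lambda>x y. blinfun_mult_right (partial_y w (x, y))"
  have "((\<lambda>(x, y). w (x, y)) has_derivative (\<lambda>(tx, ty). partial_x w (x, y) * tx + ?fy x y ty))
          (at (x, y) within ?P \<times> ?P)"
  proof (rule has_derivative_partialsI)
    show "((\<lambda>x. w (x, y)) has_derivative (*) (partial_x w (x, y))) (at x within ?P)"
      using partial_x_has_derivative[OF w] p xy
      by (auto simp: has_field_derivative_def intro: has_derivative_at_withinI)
    show "((\<lambda>y. w (x, y)) has_derivative blinfun_apply (?fy x y)) (at y within ?P)"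
      if "x \<in> ?P" "y \<in> ?P" for x y
      using partial_y_has_derivative[OF w, of x y] that
      by (auto simp: has_field_derivative_def quarter_plane_def blinfun_mult_right.rep_eq
               intro: has_derivative_at_withinI)
    have "continuous_on (?P \<times> ?P) (\<lambda>p. blinfun_mult_right (partial_y w p))"
      using w unfolding quarter_plane_eq_Times by (auto intro!: continuous_intros)
    then show "continuous (at (x, y) within ?P \<times> ?P) (\<lambda>(x, y). ?fy x y)"
      using xy by (simp add: continuous_on_eq_continuous_within case_prod_unfold)
  qed (use xy in auto)
  moreover have "at (x, y) within ?P \<times> ?P = at (x, y)"
    using at_within_open[OF _ open_quarter_plane] p xy by (simp add: quarter_plane_eq_Times)
  ultimately show ?thesis
    unfolding xy by (simp add: case_prod_unfold blinfun_mult_right.rep_eq)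
qed

text \<open>The Cauchy-Riemann equations for \<open>u\<^sub>x - \<i> u\<^sub>y\<close> are Laplace's equation and the symmetry of
  the mixed derivatives.\<close>

lemma complex_gradient_holomorphic:
  assumes u: "Ck_on 2 quarter_plane u"
    and lap: "\<And>p. p \<in> quarter_plane \<Longrightarrow> laplacian u p = 0"
    and z: "Re z > 0" "Im z > 0"
  shows "(\<lambda>z. Complex (partial_x u (Re z, Im z)) (- partial_y u (Re z, Im z)))
           field_differentiable (at z)"
proof -
  let ?p = "(Re z, Im z)"
  have p: "?p \<in> quarter_plane" using z by (simp add: quarter_plane_def)
  have u1: "Ck_on (Suc 0) quarter_plane (partial_x u)" "Ck_on (Suc 0) quarter_plane (partial_y u)"
    using u by (simp_all add: numeral_2_eq_2)
  define a where "a = partial_x (partial_x u) ?p"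
  define b where "b = partial_x (partial_y u) ?p"
  have b: "partial_y (partial_x u) ?p = b" using mixed_partials_eq[OF u p] by (simp add: b_def)
  have d: "partial_y (partial_y u) ?p = - a"
    using lap[OF p] by (simp add: laplacian_def a_def)
  have R: "((\<lambda>z. (Re z, Im z)) has_derivative (\<lambda>h. (Re h, Im h))) (at z)"
    by (auto intro!: derivative_eq_intros)
  have 1: "((\<lambda>z. partial_x u (Re z, Im z)) has_derivative (\<lambda>h. a * Re h + b * Im h)) (at z)"
    using has_derivative_compose[OF R Ck_on_1_has_derivative[OF u1(1) p]] by (simp add: a_def b)
  have 2: "((\<lambda>z. partial_y u (Re z, Im z)) has_derivative (\<lambda>h. b * Re h - a * Im h)) (at z)"
    using has_derivative_compose[OF R Ck_on_1_has_derivative[OF u1(2) p]] by (simp add: b_def d)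
  have "((\<lambda>z. of_real (partial_x u (Re z, Im z)) - \<i> * of_real (partial_y u (Re z, Im z)))
          has_derivative (\<lambda>h. of_real (a * Re h + b * Im h) - \<i> * of_real (b * Re h - a * Im h))) (at z)"
    by (intro derivative_intros 1 2)
  moreover have "(\<lambda>z. of_real (partial_x u (Re z, Im z)) - \<i> * of_real (partial_y u (Re z, Im z)))
      = (\<lambda>z. Complex (partial_x u (Re z, Im z)) (- partial_y u (Re z, Im z)))"
    by (auto simp: complex_eq_iff)
  moreover have "(\<lambda>h. of_real (a * Re h + b * Im h) - \<i> * of_real (b * Re h - a * Im h))
      = (*) (Complex a (- b))"
    by (auto simp: complex_eq_iff algebra_simps)
  ultimately show ?thesis
    by (auto simp: field_differentiable_def has_field_derivative_def)
qed

abbreviation (input) closed_quadrant :: "complex set" where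
  "closed_quadrant \<equiv> {z. Re z \<ge> 0 \<and> Im z \<ge> 0}"

abbreviation (input) open_quadrant :: "complex set" where
  "open_quadrant \<equiv> {z. Re z > 0 \<and> Im z > 0}"

lemma convex_closed_quadrant: "convex closed_quadrant"
  and interior_closed_quadrant: "interior closed_quadrant = open_quadrant"
  and closure_open_quadrant: "closure open_quadrant = closed_quadrant"
  and open_open_quadrant: "open open_quadrant"
  and convex_open_quadrant: "convex open_quadrant"
proof -
  have eq: "closed_quadrant = {z. Re z \<ge> 0} \<inter> {z. Im z \<ge> 0}"
    "open_quadrant = {z. Re z > 0} \<inter> {z. Im z > 0}" by auto
  show c: "convex closed_quadrant" unfolding eq
    by (intro convex_Int convex_halfspace_Re_ge convex_halfspace_Im_ge)
  show c': "convex open_quadrant" unfolding eq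
    by (intro convex_Int convex_halfspace_Re_gt convex_halfspace_Im_gt)
  have cl: "closed closed_quadrant" unfolding eq
    by (intro closed_Int closed_halfspace_Re_ge closed_halfspace_Im_ge)
  show o: "open open_quadrant" unfolding eq
    by (intro open_Int open_halfspace_Re_gt open_halfspace_Im_gt)
  show i: "interior closed_quadrant = open_quadrant"
    unfolding eq interior_Int
    using interior_halfspace_ge[of "1 :: complex" 0] interior_halfspace_ge[of \<i> 0]
    by (simp add: inner_complex_def)
  have "1 + \<i> \<in> open_quadrant" by simp
  then have "interior closed_quadrant \<noteq> {}" unfolding i by blast
  then show "closure open_quadrant = closed_quadrant"
    using convex_closure_interior[OF c] closure_closed[OF cl] by (simp add: i)
qed

text \<open>A solution is the real part of a function that is holomorphic in the open quadrant and
  continuous up to the boundary. Its imaginary part is, on the positive real axis, a primitive of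
  the boundary flux \<open>f (u)\<close>.\<close>

lemma holomorphic_completion:
  assumes sol: "nonneg_classical_solution f u"
  obtains \<Phi> where "continuous_on closed_quadrant \<Phi>" "\<Phi> holomorphic_on open_quadrant" "\<Phi> 0 = 0"
    "\<And>z. z \<in> closed_quadrant \<Longrightarrow> Re (\<Phi> z) = u (Re z, Im z)"
    "\<And>t. t > 0 \<Longrightarrow> ((\<lambda>t. Im (\<Phi> (of_real t))) has_real_derivative f (u (t, 0))) (at t)"
proof -
  from sol have u2: "Ck_on 2 quarter_plane u" and u1: "C1_on_closure quarter_plane u"
    and lap: "\<And>p. p \<in> quarter_plane \<Longrightarrow> laplacian u p = 0"
    and bdry: "\<And>y. y \<ge> 0 \<Longrightarrow> u (0, y) = 0"
    and neu: "\<And>x. x > 0 \<Longrightarrow> ((\<lambda>y. u (x, y)) has_real_derivative - f (u (x, 0))) (at 0 within {0..})"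
    by (auto simp: nonneg_classical_solution_def has_normal_derivative_at_bottom_def)
  from u1 obtain v w where cont: "continuous_on ({0..} \<times> {0..}) u"
      "continuous_on ({0..} \<times> {0..}) v" "continuous_on ({0..} \<times> {0..}) w"
    and vw: "\<And>p. p \<in> quarter_plane \<Longrightarrow> v p = partial_x u p \<and> w p = partial_y u p"
    unfolding C1_on_closure_def closure_quarter_plane by metis
  have uS: "Ck_on (Suc (Suc 0)) quarter_plane u" using u2 by (simp add: numeral_2_eq_2)
  have uS1: "Ck_on (Suc 0) quarter_plane u" using uS by auto
  define F where "F = (\<lambda>z. Complex (v (Re z, Im z)) (- w (Re z, Im z)))"
  have contF: "continuous_on closed_quadrant F"
    unfolding F_def
    by (intro continuous_on_Complex continuous_on_minus
          continuous_on_compose2[OF cont(2)] continuous_on_compose2[OF cont(3)]) (auto intro!: continuous_intros)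
  have contu: "continuous_on closed_quadrant (\<lambda>z. u (Re z, Im z))"
    by (intro continuous_on_compose2[OF cont(1)]) (auto intro!: continuous_intros)
  have holF: "F field_differentiable at z" if "z \<in> interior closed_quadrant - {}" for z
  proof -
    have z: "z \<in> open_quadrant" using that by (simp only: interior_closed_quadrant) auto
    have "(\<lambda>z. Complex (partial_x u (Re z, Im z)) (- partial_y u (Re z, Im z))) field_differentiable (at z)"
      using z by (intro complex_gradient_holomorphic u2 lap) auto
    then show ?thesis
      unfolding field_differentiable_def
      using has_field_derivative_transform_within_open[OF _ open_open_quadrant z, of _ _ F]
      by (fastforce simp: F_def vw quarter_plane_def)
  qed
  obtain G where G: "\<And>z. z \<in> closed_quadrant \<Longrightarrow> (G has_field_derivative F z) (at z within closed_quadrant)"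
    using holomorphic_convex_primitive[OF convex_closed_quadrant finite.emptyI contF holF] by blast
  define \<Phi> where "\<Phi> = (\<lambda>z. G z - G 0)"
  have \<Phi>': "(\<Phi> has_field_derivative F z) (at z within closed_quadrant)" if "z \<in> closed_quadrant" for z
    using G[OF that] unfolding \<Phi>_def by (auto intro!: derivative_eq_intros)
  have cont\<Phi>: "continuous_on closed_quadrant \<Phi>"
    using \<Phi>' by (rule DERIV_continuous_on)
  have \<Phi>'_open: "(\<Phi> has_field_derivative F z) (at z)" if z: "z \<in> open_quadrant" for z
  proof -
    have "(\<Phi> has_field_derivative F z) (at z within open_quadrant)"
      using z by (intro DERIV_subset[OF \<Phi>']) auto
    then show ?thesis using at_within_open[OF z open_open_quadrant] by simp
  qed
  have hol\<Phi>: "\<Phi> holomorphic_on open_quadrant"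
    using \<Phi>'_open open_open_quadrant by (meson holomorphic_on_open)
  have "\<exists>c. \<forall>z\<in>open_quadrant. Re (\<Phi> z) - u (Re z, Im z) = c"
  proof (rule has_derivative_zero_constant[OF convex_open_quadrant])
    fix z assume z: "z \<in> open_quadrant"
    then have p: "(Re z, Im z) \<in> quarter_plane" by (simp add: quarter_plane_def)
    have R: "((\<lambda>z. (Re z, Im z)) has_derivative (\<lambda>h. (Re h, Im h))) (at z)"
      by (auto intro!: derivative_eq_intros)
    have 1: "((\<lambda>z. u (Re z, Im z)) has_derivative
        (\<lambda>h. partial_x u (Re z, Im z) * Re h + partial_y u (Re z, Im z) * Im h)) (at z)"
      using has_derivative_compose[OF R Ck_on_1_has_derivative[OF uS1 p]] by simp
    have 2: "((\<lambda>z. Re (\<Phi> z)) has_derivative (\<lambda>h. Re (F z * h))) (at z)"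
      using \<Phi>'_open[OF z] by (auto simp: has_field_derivative_def intro!: derivative_eq_intros)
    have "((\<lambda>z. Re (\<Phi> z) - u (Re z, Im z)) has_derivative (\<lambda>h. 0)) (at z)"
      using has_derivative_diff[OF 2 1] by (simp add: F_def vw[OF p])
    then show "((\<lambda>z. Re (\<Phi> z) - u (Re z, Im z)) has_derivative (\<lambda>h. 0)) (at z within open_quadrant)"
      by (rule has_derivative_at_withinI)
  qed
  then obtain c where c: "\<And>z. z \<in> open_quadrant \<Longrightarrow> Re (\<Phi> z) - u (Re z, Im z) = c" by blast
  have c': "Re (\<Phi> z) - u (Re z, Im z) = c" if "z \<in> closed_quadrant" for z
  proof (rule continuous_constant_on_closure[of open_quadrant "\<lambda>z. Re (\<Phi> z) - u (Re z, Im z)"])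
    show "continuous_on (closure open_quadrant) (\<lambda>z. Re (\<Phi> z) - u (Re z, Im z))"
      unfolding closure_open_quadrant by (intro continuous_intros cont\<Phi> contu)
    show "z \<in> closure open_quadrant" using that by (simp add: closure_open_quadrant)
  qed (use c in auto)
  have "c = 0" using c'[of 0] bdry[of 0] by (simp add: \<Phi>_def)
  with c' have Re\<Phi>: "Re (\<Phi> z) = u (Re z, Im z)" if "z \<in> closed_quadrant" for z
    using that by fastforce
  have Im\<Phi>: "((\<lambda>t. Im (\<Phi> (of_real t))) has_real_derivative f (u (t, 0))) (at t)" if t: "t > 0" for t
  proof -
    have line: "((\<lambda>y. \<Phi> (of_real t + of_real y * d)) has_derivative (\<lambda>h. F (of_real t) * (of_real h * d)))
        (at 0 within S)" if "\<And>y. y \<in> S \<Longrightarrow> of_real t + of_real y * d \<in> closed_quadrant" for d S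
    proof (rule has_derivative_in_compose[where f = "\<lambda>y. of_real t + of_real y * d" and g = \<Phi>
          and f' = "\<lambda>h. of_real h * d" and g' = "(*) (F (of_real t))"])
      show "((\<lambda>y. of_real t + of_real y * d) has_derivative (\<lambda>h. of_real h * d)) (at 0 within S)"
        by (auto intro!: derivative_eq_intros)
      have "(\<Phi> has_field_derivative F (of_real t)) (at (of_real t) within (\<lambda>y. of_real t + of_real y * d) ` S)"
        using that t by (intro DERIV_subset[OF \<Phi>']) auto
      then show "(\<Phi> has_derivative (*) (F (of_real t)))
          (at (of_real t + of_real 0 * d) within (\<lambda>y. of_real t + of_real y * d) ` S)"
        by (simp add: has_field_derivative_def)
    qed
    have "((\<lambda>y. \<Phi> (of_real t + of_real y * \<i>)) has_derivative (\<lambda>h. F (of_real t) * (of_real h * \<i>)))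
        (at 0 within {0..})"
      using t by (intro line) auto
    then have "((\<lambda>y. Re (\<Phi> (of_real t + of_real y * \<i>))) has_derivative
        (\<lambda>h. Re (F (of_real t) * (of_real h * \<i>)))) (at 0 within {0..})"
      by (auto intro!: derivative_eq_intros)
    then have "((\<lambda>y. Re (\<Phi> (of_real t + of_real y * \<i>))) has_real_derivative (w (t, 0))) (at 0 within {0..})"
      by (simp add: has_field_derivative_def F_def mult_commute_abs)
    then have "((\<lambda>y. u (t, y)) has_real_derivative (w (t, 0))) (at 0 within {0..})"
      by (rule has_field_derivative_transform_within[OF _ zero_less_one]) (use t in \<open>auto simp: Re\<Phi>\<close>)
    then have wt: "w (t, 0) = - f (u (t, 0))"
      using neu[OF t] unfolding has_real_derivative_iff_has_vector_derivative
      by (intro vector_derivative_unique_within) (auto simp: at_within_Ici_at_right)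
    have "((\<lambda>s. \<Phi> (of_real t + of_real s * 1)) has_derivative (\<lambda>h. F (of_real t) * (of_real h * 1)))
        (at 0 within {- t<..})"
      by (intro line) auto
    then have "((\<lambda>s. Im (\<Phi> (of_real t + of_real s * 1))) has_derivative
        (\<lambda>h. Im (F (of_real t) * (of_real h * 1)))) (at 0 within {- t<..})"
      by (auto intro!: derivative_eq_intros)
    then have "((\<lambda>s. Im (\<Phi> (of_real (t + s)))) has_real_derivative f (u (t, 0))) (at 0)"
      using t by (simp add: has_field_derivative_def F_def wt mult_commute_abs at_within_open[of _ "{- t<..}"])
    then show ?thesis
      using DERIV_at_within_shift[of "\<lambda>s. Im (\<Phi> (of_real s))" "f (u (t, 0))" t 0 UNIV] by (simp add: add.commute)
  qed
  show ?thesis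
    by (rule that[of \<Phi>]) (fact cont\<Phi> hol\<Phi> Re\<Phi> Im\<Phi> | simp add: \<Phi>_def)+
qed

section \<open>Green's representation in a quarter disc\<close>

abbreviation quarter_circle :: "real \<Rightarrow> real \<Rightarrow> complex" where
  "quarter_circle R \<equiv> part_circlepath 0 R 0 (pi / 2)"

abbreviation quarter_disc_boundary :: "real \<Rightarrow> real \<Rightarrow> complex" where
  "quarter_disc_boundary R \<equiv>
     linepath 0 (of_real R) +++ quarter_circle R +++ linepath (\<i> * of_real R) 0"

lemma part_circlepath_endpoints_cis:
  "pathstart (part_circlepath z r a b) = z + r * cis a"
  "pathfinish (part_circlepath z r a b) = z + r * cis b"
  by (simp_all add: cis_conv_exp)

lemma cis_3pi_half: "cis (3 * pi / 2) = - \<i>"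
proof -
  have "cis (3 * pi / 2) = cis pi * cis (pi / 2)" by (simp only: cis_mult) (simp add: field_simps)
  then show ?thesis by simp
qed

lemma exp_i_pi_half: "exp (\<i> * of_real pi / 2) = \<i>"
  using cis_conv_exp[of "pi / 2"] by simp

lemma exp_i_2pi: "exp (\<i> * (2 * of_real pi)) = 1"
  using cis_conv_exp[of "2 * pi"] by simp

lemma exp_i_3pi_half: "exp (\<i> * (3 * of_real pi) / 2) = - \<i>"
  using cis_conv_exp[of "3 * pi / 2"] cis_3pi_half by simp

lemma path_image_part_circlepath_cis:
  "a \<le> b \<Longrightarrow> path_image (part_circlepath 0 r a b) = (\<lambda>t. of_real r * cis t) ` {a..b}"
  by (auto simp: path_image_part_circlepath cis_conv_exp)

lemma linepath_in_convex: "convex S \<Longrightarrow> a \<in> S \<Longrightarrow> b \<in> S \<Longrightarrow> path_image (linepath a b) \<subseteq> S"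
  by (simp add: closed_segment_subset)

text \<open>The full circle is the sum of the boundaries of the quarter disc, of the left half disc and of
  the quarter disc below the real axis. The latter two lie in half-planes that do not contain the
  point.\<close>

lemma winding_number_quarter_disc_boundary:
  assumes z: "Re z > 0" "Im z > 0" "norm z < R"
  shows "winding_number (quarter_disc_boundary R) z = 1"
    and "z \<notin> path_image (quarter_disc_boundary R)"
    and "path_image (quarter_disc_boundary R) \<subseteq> {w. Re w \<ge> 0 \<and> Im w \<ge> 0} \<inter> cball 0 R"
    and "valid_path (quarter_disc_boundary R)"
    and "pathfinish (quarter_disc_boundary R) = pathstart (quarter_disc_boundary R)"
proof -
  have R: "R > 0" using z by (meson norm_ge_zero le_less_trans)
  let ?k = "\<lambda>w. 1 / (w - z)"
  let ?C = "\<lambda>g. contour_integral g ?k"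
  note ends = part_circlepath_endpoints_cis exp_i_2pi exp_i_3pi_half exp_i_pi_half
  show loop: "pathfinish (quarter_disc_boundary R) = pathstart (quarter_disc_boundary R)"
    by simp
  show vp: "valid_path (quarter_disc_boundary R)"
    by (intro valid_path_join) (auto simp: ends)
  have conv: "convex (closed_quadrant \<inter> cball 0 R)"
    by (intro convex_Int convex_closed_quadrant convex_cball)
  define T where "T = (closed_quadrant \<inter> cball 0 R) \<inter> ({w. Im w = 0} \<union> {w. Re w = 0} \<union> sphere 0 R)"
  have "path_image (quarter_circle R) \<subseteq> T"
    using R by (auto simp: T_def path_image_part_circlepath_cis norm_mult
        intro!: mult_nonneg_nonneg cos_ge_zero sin_ge_zero)
  moreover have "path_image (linepath 0 (of_real R)) \<subseteq> T"
    using R by (auto simp: T_def closed_segment_def norm_mult mult_le_one)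
  moreover have "path_image (linepath (\<i> * of_real R) 0) \<subseteq> T"
    using R by (auto simp: T_def closed_segment_def norm_mult mult_le_one)
  ultimately have sub: "path_image (quarter_disc_boundary R) \<subseteq> T"
    by (auto simp: path_image_join part_circlepath_endpoints_cis exp_i_pi_half)
  then show "path_image (quarter_disc_boundary R) \<subseteq> closed_quadrant \<inter> cball 0 R"
    unfolding T_def by blast
  show zn: "z \<notin> path_image (quarter_disc_boundary R)" using sub z by (auto simp: T_def)
  define J where "J = (\<lambda>a b. ?C (part_circlepath 0 R a b))"
  have ne: "of_real R * cis t \<noteq> z" for t using z R by (auto simp: norm_mult)
  have cont: "continuous_on S (\<lambda>t. ?k (0 + of_real R * cis t) * of_real R * \<i> * cis t)" for S
    using ne by (intro continuous_intros) auto
  have J: "J a b = integral {a..b} (\<lambda>t. ?k (0 + of_real R * cis t) * of_real R * \<i> * cis t)" if "a < b" for a b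
    unfolding J_def by (rule contour_integral_part_circlepath_eq[OF that])
  have J_add: "J a b + J b c = J a c" if "a < b" "b < c" for a b c
    using that by (simp only: J Henstock_Kurzweil_Integration.integral_combine[OF _ _ integrable_continuous_interval[OF cont]] less_imp_le)
  have "J 0 (2 * pi) = 2 * pi * \<i>"
  proof -
    have "((\<lambda>w. 1 / (w - z)) has_contour_integral (2 * of_real pi * \<i> * 1)) (circlepath 0 R)"
      using z by (intro Cauchy_integral_circlepath) auto
    then show ?thesis by (simp add: J_def circlepath_def contour_integral_unique)
  qed
  have cint: "?k contour_integrable_on linepath a b" if "z \<notin> closed_segment a b" for a b
    using that by (intro contour_integrable_continuous_linepath continuous_intros) auto
  have cintp: "?k contour_integrable_on part_circlepath 0 R a b" if "a < b" for a b
    unfolding contour_integrable_part_circlepath_iff[OF that]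
    by (rule integrable_continuous_interval[OF cont])
  have nseg: "z \<notin> closed_segment a b" if "Re a \<le> 0 \<and> Re b \<le> 0 \<or> Im a \<le> 0 \<and> Im b \<le> 0" for a b
  proof
    assume "z \<in> closed_segment a b"
    then have "Re z \<in> closed_segment (Re a) (Re b)" "Im z \<in> closed_segment (Im a) (Im b)"
      by (metis closed_segment_linear_image bounded_linear_Re bounded_linear_Im bounded_linear.linear imageI)+
    then show False using z that by (auto simp: closed_segment_eq_real_ivl split: if_splits)
  qed
  have arc2: "J (pi / 2) (3 * pi / 2) + ?C (linepath (- \<i> * of_real R) (\<i> * of_real R)) = 0"
  proof -
    let ?g = "part_circlepath 0 R (pi / 2) (3 * pi / 2) +++ linepath (- \<i> * of_real R) (\<i> * of_real R)"
    have "cos t \<le> 0" if "pi / 2 \<le> t" "t \<le> 3 * pi / 2" for t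
      using cos_ge_zero[of "t - pi"] that by (simp add: cos_diff)
    then have "path_image (part_circlepath 0 R (pi / 2) (3 * pi / 2)) \<subseteq> {w. Re w \<le> 0}"
      using R by (auto simp: path_image_part_circlepath_cis intro!: mult_nonneg_nonpos)
    moreover have "path_image (linepath (- \<i> * of_real R) (\<i> * of_real R)) \<subseteq> {w. Re w \<le> 0}"
      by (intro linepath_in_convex convex_halfspace_Re_le) auto
    ultimately have "path_image ?g \<subseteq> {w. Re w \<le> 0}"
      by (meson path_image_join_subset le_sup_iff order_trans)
    moreover have "valid_path ?g" by (intro valid_path_join) (auto simp: ends)
    moreover have "?k holomorphic_on {w. Re w \<le> 0}" using z by (auto intro!: holomorphic_intros)
    ultimately have "(?k has_contour_integral 0) ?g"
      by (intro Cauchy_theorem_convex_simple[of _ "{w. Re w \<le> 0}"] convex_halfspace_Re_le) (auto simp: ends)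
    then have "?C ?g = 0" by (rule contour_integral_unique)
    then show ?thesis
      by (simp add: J_def cintp cint nseg)
  qed
  have arc3: "J (3 * pi / 2) (2 * pi) + (?C (linepath (of_real R) 0) + ?C (linepath 0 (- \<i> * of_real R))) = 0"
  proof -
    let ?g = "part_circlepath 0 R (3 * pi / 2) (2 * pi) +++ (linepath (of_real R) 0 +++ linepath 0 (- \<i> * of_real R))"
    have "sin t \<le> 0" if "3 * pi / 2 \<le> t" "t \<le> 2 * pi" for t
      using sin_ge_zero[of "t - pi"] that by (simp add: sin_diff)
    then have "path_image (part_circlepath 0 R (3 * pi / 2) (2 * pi)) \<subseteq> {w. Im w \<le> 0}"
      using R by (auto simp: path_image_part_circlepath_cis intro!: mult_nonneg_nonpos)
    moreover have "path_image (linepath (of_real R) 0) \<subseteq> {w. Im w \<le> 0}"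
      "path_image (linepath 0 (- \<i> * of_real R)) \<subseteq> {w. Im w \<le> 0}"
      using R by (intro linepath_in_convex convex_halfspace_Im_le; simp)+
    ultimately have "path_image ?g \<subseteq> {w. Im w \<le> 0}"
      by (meson path_image_join_subset le_sup_iff order_trans)
    moreover have "valid_path ?g" by (intro valid_path_join) (auto simp: ends)
    moreover have "?k holomorphic_on {w. Im w \<le> 0}" using z by (auto intro!: holomorphic_intros)
    ultimately have "(?k has_contour_integral 0) ?g"
      by (intro Cauchy_theorem_convex_simple[of _ "{w. Im w \<le> 0}"] convex_halfspace_Im_le) (auto simp: ends)
    then have "?C ?g = 0" by (rule contour_integral_unique)
    then show ?thesis
      using R by (simp add: J_def cintp cint nseg contour_integrable_joinI)
  qed
  have z0: "0 \<in> closed_segment (- \<i> * of_real R) (\<i> * of_real R)"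
    by (auto simp: closed_segment_def intro!: exI[of _ "1/2"])
  have "continuous_on (closed_segment (- \<i> * of_real R) (\<i> * of_real R)) ?k"
    using nseg[of "- \<i> * of_real R" "\<i> * of_real R"] by (intro continuous_intros) auto
  then have split: "?C (linepath (- \<i> * of_real R) (\<i> * of_real R))
      = ?C (linepath (- \<i> * of_real R) 0) + ?C (linepath 0 (\<i> * of_real R))"
    using z0 by (rule contour_integral_split_linepath)
  have rev: "?C (linepath a b) = - ?C (linepath b a)" if "z \<notin> closed_segment a b" for a b
    using that by (intro contour_integral_reverse_linepath continuous_intros) auto
  have J_sum: "J 0 (pi / 2) + J (pi / 2) (3 * pi / 2) + J (3 * pi / 2) (2 * pi) = 2 * pi * \<i>"
    using J_add[of 0 "pi / 2" "3 * pi / 2"] J_add[of 0 "3 * pi / 2" "2 * pi"] \<open>J 0 (2 * pi) = _\<close> by simp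
  have "?C (quarter_disc_boundary R)
      = ?C (linepath 0 (of_real R)) + (J 0 (pi / 2) + ?C (linepath (\<i> * of_real R) 0))"
    using R by (simp add: J_def cintp cint nseg contour_integrable_joinI ends)
  also have "J 0 (pi / 2) = 2 * pi * \<i> - J (pi / 2) (3 * pi / 2) - J (3 * pi / 2) (2 * pi)"
    using J_sum unfolding eq_diff_eq by (simp only: add_ac)
  also have "?C (linepath 0 (of_real R)) + (\<dots> + ?C (linepath (\<i> * of_real R) 0)) = 2 * pi * \<i>"
    using arc2 arc3 split rev[of 0 "of_real R"] rev[of 0 "\<i> * of_real R"] rev[of 0 "- \<i> * of_real R"] R
    by (simp add: nseg algebra_simps add_eq_0_iff)
  finally have total: "?C (quarter_disc_boundary R) = 2 * pi * \<i>" .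
  show "winding_number (quarter_disc_boundary R) z = 1"
    unfolding winding_number_valid_path[OF vp zn] total by simp
qed

text \<open>Up to a constant factor, minus the complex derivative of Green's function of the quarter disc of radius \<open>R\<close> with pole \<open>z\<close>, for
  Dirichlet conditions on the imaginary axis and the arc and Neumann conditions on the real axis.
  Reflection in the axes gives the poles \<open>\<plusminus>z\<close>, \<open>\<plusminus>cnj z\<close>, and reflection in the circle gives
  \<open>\<plusminus>R\<^sup>2 / z\<close>, \<open>\<plusminus>R\<^sup>2 / cnj z\<close>. The derivative is used in place of Green's function because it is
  rational: Cauchy's formula applies without branches of the logarithm.\<close>

definition kernel_half :: "real \<Rightarrow> complex \<Rightarrow> complex \<Rightarrow> complex" where
  "kernel_half R z w = 2 * z / (w\<^sup>2 - z\<^sup>2) + 2 * z * of_real (R\<^sup>2) / (of_real (R ^ 4) - z\<^sup>2 * w\<^sup>2)"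

definition green_kernel :: "real \<Rightarrow> complex \<Rightarrow> complex \<Rightarrow> complex" where
  "green_kernel R z w = kernel_half R z w + kernel_half R (cnj z) w"

lemma green_kernel_cnj: "cnj (green_kernel R z w) = green_kernel R z (cnj w)"
  by (simp add: green_kernel_def kernel_half_def add_ac)

lemma green_kernel_minus: "green_kernel R z (- w) = green_kernel R z w"
  by (simp add: green_kernel_def kernel_half_def)

lemma Im_green_kernel_real_axis: "Im (green_kernel R z (of_real t)) = 0"
  using green_kernel_cnj[of R z "of_real t"] by (simp add: complex_eq_iff)

lemma Im_green_kernel_imag_axis: "Im (green_kernel R z (\<i> * of_real t)) = 0"
  using green_kernel_cnj[of R z "\<i> * of_real t"] green_kernel_minus[of R z "\<i> * of_real t"]
  by (simp add: complex_eq_iff)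

text \<open>On the arc \<open>R\<^sup>2 = w * cnj w\<close>, so the reflection in the circle pairs each term with its
  conjugate.\<close>

lemma green_kernel_arc:
  assumes w: "norm w = R" and z: "norm z < R"
  shows "w * green_kernel R z w
      = of_real (2 * Re (2 * z * w / (w\<^sup>2 - z\<^sup>2) + 2 * cnj z * w / (w\<^sup>2 - (cnj z)\<^sup>2)))"
proof -
  have half: "w * kernel_half R z w = 2 * z * w / (w\<^sup>2 - z\<^sup>2) + 2 * z * cnj w / ((cnj w)\<^sup>2 - z\<^sup>2)"
    if z: "norm z < R" for z
  proof -
    have w0: "w \<noteq> 0" using w z by auto
    have R2: "of_real (R\<^sup>2) = w * cnj w" using complex_norm_square[of w] w by simp
    have "complex_of_real (R ^ 4) = (of_real (R\<^sup>2))\<^sup>2" by simp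
    then have R4: "complex_of_real (R ^ 4) = (w * cnj w)\<^sup>2" by (simp only: R2)
    have ne: "(cnj w)\<^sup>2 - z\<^sup>2 \<noteq> 0"
    proof
      assume "(cnj w)\<^sup>2 - z\<^sup>2 = 0"
      then have "norm (cnj w) = norm z" by (metis eq_iff_diff_eq_0 power2_eq_iff norm_minus_cancel)
      then show False using w z by simp
    qed
    have "(w * cnj w)\<^sup>2 - z\<^sup>2 * w\<^sup>2 = w\<^sup>2 * ((cnj w)\<^sup>2 - z\<^sup>2)" by (simp add: algebra_simps power_mult_distrib)
    then have "w * (2 * z * (w * cnj w) / ((w * cnj w)\<^sup>2 - z\<^sup>2 * w\<^sup>2)) = 2 * z * cnj w / ((cnj w)\<^sup>2 - z\<^sup>2)"
      using w0 ne by (simp add: field_simps power2_eq_square)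
    then show ?thesis unfolding kernel_half_def R4 by (simp only: R2) (simp add: algebra_simps)
  qed
  have "w * green_kernel R z w = (2 * z * w / (w\<^sup>2 - z\<^sup>2) + 2 * cnj z * w / (w\<^sup>2 - (cnj z)\<^sup>2))
      + cnj (2 * z * w / (w\<^sup>2 - z\<^sup>2) + 2 * cnj z * w / (w\<^sup>2 - (cnj z)\<^sup>2))"
    using half[OF z] half[of "cnj z"] z by (simp add: green_kernel_def distrib_left)
  then show ?thesis by (simp only: complex_add_cnj)
qed

lemma Im_integral:
  fixes f :: "real \<Rightarrow> complex"
  assumes "f integrable_on S"
  shows "Im (integral S f) = integral S (\<lambda>t. Im (f t))"
  using integral_linear[OF assms bounded_linear_Im] by (simp add: o_def)

text \<open>Green's formula, as the imaginary part of Cauchy's formula for \<open>\<Phi>\<close> times the kernel. Only one of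
  the poles of the kernel lies in the quarter disc. The kernel is real on both axes, so the real axis
  contributes \<open>Im \<Phi>\<close> and the imaginary axis, where \<open>\<Phi>\<close> is imaginary, contributes nothing.\<close>

lemma cauchy_quarter_disc:
  assumes cont: "continuous_on closed_quadrant \<Phi>" and hol: "\<Phi> holomorphic_on open_quadrant"
    and imag: "\<And>y. y \<ge> 0 \<Longrightarrow> Re (\<Phi> (\<i> * of_real y)) = 0"
    and z: "Re z > 0" "Im z > 0" "norm z < R"
  shows "2 * pi * Re (\<Phi> z) =
      integral {0..R} (\<lambda>t. Im (\<Phi> (of_real t)) * Re (green_kernel R z (of_real t)))
    + integral {0..pi / 2} (\<lambda>\<theta>. Re (\<Phi> (of_real R * cis \<theta>))
          * Re (of_real R * cis \<theta> * green_kernel R z (of_real R * cis \<theta>)))"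
proof -
  have R: "R > 0" using z by (meson norm_ge_zero le_less_trans)
  have z0: "z \<noteq> 0" using z by auto
  define S where "S = closed_quadrant \<inter> cball 0 R"
  \<comment> \<open>\<open>h w = (w - z) * k w\<close>, with the pole at \<open>z\<close> cancelled.\<close>
  define h where "h = (\<lambda>w. \<Phi> w * (2 * z / (w + z)
      + (w - z) * (2 * z * of_real (R\<^sup>2) / (of_real (R ^ 4) - z\<^sup>2 * w\<^sup>2) + kernel_half R (cnj z) w)))"
  define k where "k = (\<lambda>w. \<Phi> w * green_kernel R z w)"
  have ne1: "w + z \<noteq> 0" if "w \<in> S" for w
    using that z by (auto simp: S_def complex_eq_iff)
  have ne2: "of_real (R ^ 4) - a\<^sup>2 * w\<^sup>2 \<noteq> 0" if "w \<in> S" "norm a < R" for a w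
  proof
    assume "of_real (R ^ 4) - a\<^sup>2 * w\<^sup>2 = 0"
    then have "norm (of_real (R ^ 4) :: complex) = norm (a\<^sup>2 * w\<^sup>2)" by simp
    then have sq: "(R\<^sup>2)\<^sup>2 = (norm a * norm w)\<^sup>2"
      using R by (simp add: norm_mult norm_power power_mult_distrib)
    have "R\<^sup>2 = norm a * norm w" by (rule power2_eq_imp_eq[OF sq]) auto
    moreover have "norm a * norm w \<le> norm a * R" using that by (intro mult_left_mono) (auto simp: S_def)
    moreover have "norm a * R < R * R" using that R by simp
    ultimately show False by (simp add: power2_eq_square)
  qed
  have ne3: "w\<^sup>2 - (cnj z)\<^sup>2 \<noteq> 0" if "w \<in> S" for w
  proof
    assume "w\<^sup>2 - (cnj z)\<^sup>2 = 0"
    then have "w = cnj z \<or> w = - cnj z" by (simp add: power2_eq_iff)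
    then show False using that z by (auto simp: S_def)
  qed
  have contS: "continuous_on S h"
    unfolding h_def kernel_half_def using ne1 ne2 ne3 z
    by (intro continuous_intros continuous_on_subset[OF cont]) (auto simp: S_def)
  have intS: "interior S = open_quadrant \<inter> ball 0 R"
    by (simp add: S_def interior_closed_quadrant)
  have holS: "h field_differentiable at w" if "w \<in> interior S - {}" for w
  proof -
    have op: "open (open_quadrant \<inter> ball 0 R)" by (intro open_Int open_open_quadrant open_ball)
    have "h holomorphic_on open_quadrant \<inter> ball 0 R"
      unfolding h_def kernel_half_def using ne1 ne2 ne3 z interior_subset[of S]
      by (intro holomorphic_intros holomorphic_on_subset[OF hol]) (auto simp: intS subset_iff)
    then show ?thesis using that op unfolding intS by (auto intro: holomorphic_on_imp_differentiable_at)
  qed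
  note W = winding_number_quarter_disc_boundary[OF z]
  have convS: "convex S" unfolding S_def by (intro convex_Int convex_closed_quadrant convex_cball)
  have zS: "z \<in> interior S" using z by (simp add: intS)
  have h_eq: "h w / (w - z) = k w" if "w \<noteq> z" "w \<in> S" for w
  proof -
    have "(w + z) * (w - z) = w\<^sup>2 - z\<^sup>2" by (simp add: power2_eq_square algebra_simps)
    then show ?thesis using that
      by (simp add: h_def k_def green_kernel_def kernel_half_def[of R z] add_divide_distrib distrib_left mult.assoc)
  qed
  have PI: "path_image (quarter_disc_boundary R) \<subseteq> S - {z}" using W(2,3) by (auto simp: S_def)
  have "((\<lambda>w. h w / (w - z)) has_contour_integral
      2 * pi * \<i> * winding_number (quarter_disc_boundary R) z * h z) (quarter_disc_boundary R)"
    by (rule Cauchy_integral_formula_weak[OF convS finite.emptyI contS holS _ W(4) PI W(5)]) (use zS in auto)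
  moreover have "h z = \<Phi> z" using z0 by (simp add: h_def)
  ultimately have "((\<lambda>w. h w / (w - z)) has_contour_integral 2 * pi * \<i> * \<Phi> z) (quarter_disc_boundary R)"
    by (simp add: W(1))
  then have main: "(k has_contour_integral 2 * pi * \<i> * \<Phi> z) (quarter_disc_boundary R)"
    by (rule has_contour_integral_eq) (use PI h_eq in auto)
  have contk: "continuous_on (S - {z}) k"
    by (rule continuous_on_eq[of _ "\<lambda>w. h w / (w - z)"])
      (auto intro!: continuous_intros continuous_on_subset[OF contS] h_eq)
  have PI3: "path_image (linepath 0 (of_real R)) \<subseteq> S - {z}"
    "path_image (quarter_circle R) \<subseteq> S - {z}" "path_image (linepath (\<i> * of_real R) 0) \<subseteq> S - {z}"
    using PI by (auto simp: path_image_join part_circlepath_endpoints_cis exp_i_pi_half)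
  have int: "k contour_integrable_on linepath 0 (of_real R)" "k contour_integrable_on linepath (\<i> * of_real R) 0"
    using PI3 by (auto intro!: contour_integrable_continuous_linepath continuous_on_subset[OF contk])
  have int2: "k contour_integrable_on quarter_circle R"
    by (rule contour_integrable_continuous_part_circlepath[OF continuous_on_subset[OF contk PI3(2)]])
  have "2 * pi * \<i> * \<Phi> z = contour_integral (linepath 0 (of_real R)) k
      + (contour_integral (quarter_circle R) k + contour_integral (linepath (\<i> * of_real R) 0) k)"
    using contour_integral_unique[OF main] int int2
    by (simp add: contour_integrable_joinI part_circlepath_endpoints_cis exp_i_pi_half)
  then have "2 * pi * Re (\<Phi> z) = Im (contour_integral (linepath 0 (of_real R)) k)
      + Im (contour_integral (quarter_circle R) k) + Im (contour_integral (linepath (\<i> * of_real R) 0) k)"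
    by (auto simp: complex_eq_iff)
  moreover have "Im (contour_integral (linepath 0 (of_real R)) k)
      = integral {0..R} (\<lambda>t. Im (\<Phi> (of_real t)) * Re (green_kernel R z (of_real t)))"
  proof -
    have "(\<lambda>t. k (of_real t)) integrable_on {0..R}"
      using int(1) R contour_integrable_linepath_Reals_iff[of 0 "of_real R" k] by simp
    moreover have "contour_integral (linepath 0 (of_real R)) k = integral {0..R} (\<lambda>t. k (of_real t))"
      using R by (subst contour_integral_linepath_Reals_eq) auto
    ultimately show ?thesis
      by (simp add: Im_integral k_def Im_green_kernel_real_axis)
  qed
  moreover have "Im (contour_integral (quarter_circle R) k) = integral {0..pi / 2} (\<lambda>\<theta>.
      Re (\<Phi> (of_real R * cis \<theta>)) * Re (of_real R * cis \<theta> * green_kernel R z (of_real R * cis \<theta>)))"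
  proof -
    have pi0: "0 < pi / 2" by simp
    have "(\<lambda>t. k (0 + of_real R * cis t) * of_real R * \<i> * cis t) integrable_on {0..pi / 2}"
      using int2 contour_integrable_part_circlepath_iff[OF pi0] by blast
    then have "Im (contour_integral (quarter_circle R) k)
        = integral {0..pi / 2} (\<lambda>t. Im (k (0 + of_real R * cis t) * of_real R * \<i> * cis t))"
      by (simp only: contour_integral_part_circlepath_eq[OF pi0] Im_integral)
    also have "\<dots> = integral {0..pi / 2} (\<lambda>\<theta>.
      Re (\<Phi> (of_real R * cis \<theta>)) * Re (of_real R * cis \<theta> * green_kernel R z (of_real R * cis \<theta>)))"
    proof (rule integral_cong)
      fix t
      let ?w = "of_real R * cis t"
      define P where "P = ?w * green_kernel R z ?w"
      have "norm ?w = R" using R by (simp add: norm_mult)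
      then have "Im P = 0" using green_kernel_arc[of ?w R z] z(3) by (simp add: P_def)
      moreover have "k (0 + ?w) * of_real R * \<i> * cis t = \<i> * (\<Phi> ?w * P)"
        by (simp add: k_def P_def algebra_simps)
      moreover have "Im (\<i> * (\<Phi> ?w * P)) = Re (\<Phi> ?w) * Re P" using \<open>Im P = 0\<close> by simp
      ultimately have "Im (k (0 + ?w) * of_real R * \<i> * cis t) = Re (\<Phi> ?w) * Re P" by (simp only:)
      then show "Im (k (0 + ?w) * of_real R * \<i> * cis t) = Re (\<Phi> ?w) * Re (?w * green_kernel R z ?w)"
        by (simp only: P_def)
    qed
    finally show ?thesis .
  qed
  moreover have "Im (contour_integral (linepath (\<i> * of_real R) 0) k) = 0"
  proof -
    define I where "I = contour_integral (linepath (\<i> * of_real R) 0) k"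
    have "(k has_contour_integral - I) (linepath 0 (\<i> * of_real R))"
      using has_contour_integral_reversepath[OF valid_path_linepath has_contour_integral_integral[OF int(2)]]
      by (simp add: I_def)
    then have I: "((\<lambda>y. k (Complex 0 y)) has_integral \<i> * I) {0..R}"
      using R by (subst (asm) has_contour_integral_linepath_same_Re_iff) auto
    have "((\<lambda>y. Re (k (Complex 0 y))) has_integral Re (\<i> * I)) {0..R}"
      using has_integral_linear[OF I bounded_linear_Re] by (simp add: o_def)
    moreover have "Re (k (Complex 0 y)) = 0" if "y \<in> {0..R}" for y
    proof -
      have "Complex 0 y = \<i> * of_real y" by (simp add: complex_eq_iff)
      then show ?thesis using imag[of y] that by (simp add: k_def Im_green_kernel_imag_axis)
    qed
    ultimately have "((\<lambda>y. 0) has_integral Re (\<i> * I)) {0..R}"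
      by (subst (asm) has_integral_cong[where g = "\<lambda>y. 0"]) auto
    then have "Re (\<i> * I) = 0" by (rule has_integral_unique) simp
    then show ?thesis by (simp add: I_def)
  qed
  ultimately show ?thesis by simp
qed

section \<open>The representation formula in the quarter plane\<close>

text \<open>\<open>green_log x y t / (2 * pi)\<close> is the value at the boundary point \<open>(t, 0)\<close> of Green's function of
  the quarter plane with pole \<open>(x, y)\<close>, for Dirichlet conditions on \<open>x = 0\<close> and Neumann conditions on
  \<open>y = 0\<close>. \<open>green_image R x y t\<close> is the correction by the poles reflected in the circle of radius \<open>R\<close>.\<close>

definition green_log :: "real \<Rightarrow> real \<Rightarrow> real \<Rightarrow> real" where
  "green_log x y t = ln (((t + x)\<^sup>2 + y\<^sup>2) / ((t - x)\<^sup>2 + y\<^sup>2))"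

definition green_image :: "real \<Rightarrow> real \<Rightarrow> real \<Rightarrow> real \<Rightarrow> real" where
  "green_image R x y t = ln (((R\<^sup>2 + x * t)\<^sup>2 + (y * t)\<^sup>2) / ((R\<^sup>2 - x * t)\<^sup>2 + (y * t)\<^sup>2))"

lemma sum_squares_pos: "(b::real) > 0 \<Longrightarrow> a\<^sup>2 + b\<^sup>2 > 0"
  by (simp add: add_nonneg_pos)

lemma sum_squares_pos': "(a::real) > 0 \<Longrightarrow> a\<^sup>2 + b\<^sup>2 > 0"
  by (simp add: add_pos_nonneg)

lemma continuous_on_green_log: "y > 0 \<Longrightarrow> continuous_on S (green_log x y)"
  unfolding green_log_def
  by (intro continuous_intros) (auto simp: sum_squares_pos less_imp_neq[symmetric])

lemma continuous_on_green_log_mult: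
  "y > 0 \<Longrightarrow> continuous_on S g \<Longrightarrow> continuous_on S (\<lambda>t. green_log x y t * g t)"
  by (intro continuous_intros continuous_on_green_log)

lemma image_pos:
  fixes x t R :: real
  assumes "0 \<le> t" "t \<le> R" "0 < x" "x < R"
  shows "R\<^sup>2 - x * t > 0" "R\<^sup>2 + x * t > 0"
proof -
  have "x * t \<le> x * R" using assms by (intro mult_left_mono) auto
  also have "x * R < R * R" using assms by simp
  finally show "R\<^sup>2 - x * t > 0" by (simp add: power2_eq_square)
  show "R\<^sup>2 + x * t > 0" using assms by (auto intro!: add_pos_nonneg)
qed

lemma ln_ratio_nonneg: "0 < b \<Longrightarrow> b \<le> a \<Longrightarrow> ln (a / b :: real) \<ge> 0"
  by (intro ln_ge_zero) auto

lemma green_log_nonneg: "x > 0 \<Longrightarrow> y > 0 \<Longrightarrow> t \<ge> 0 \<Longrightarrow> green_log x y t \<ge> 0"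
  unfolding green_log_def
  by (intro ln_ratio_nonneg sum_squares_pos) (auto simp: power2_eq_square algebra_simps)

lemma green_image_nonneg:
  assumes "0 \<le> t" "t \<le> R" "0 < x" "x < R"
  shows "green_image R x y t \<ge> 0"
  unfolding green_image_def using image_pos[OF assms] assms
  by (intro ln_ratio_nonneg sum_squares_pos') (auto simp: power2_eq_square algebra_simps)

text \<open>Green's function of the quarter disc is nonnegative because \<open>(R\<^sup>2 - t\<^sup>2) (R\<^sup>2 - x\<^sup>2 - y\<^sup>2) \<ge> 0\<close>.\<close>

lemma green_image_le_green_log:
  assumes t: "0 \<le> t" "t \<le> R" and x: "0 < x" and y: "0 < y" and R: "x\<^sup>2 + y\<^sup>2 < R\<^sup>2"
  shows "green_image R x y t \<le> green_log x y t"
proof -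
  have xR: "x < R"
  proof (rule power2_less_imp_less)
    show "x\<^sup>2 < R\<^sup>2" using R zero_le_power2[of y] by linarith
  qed (use t in auto)
  note p = image_pos[OF t x xR]
  have "(R\<^sup>2 - t\<^sup>2) * (R\<^sup>2 - (x\<^sup>2 + y\<^sup>2)) \<ge> 0"
    using R t by (intro mult_nonneg_nonneg) (auto intro: power_mono)
  then have "4 * x * t * ((R\<^sup>2 - t\<^sup>2) * (R\<^sup>2 - (x\<^sup>2 + y\<^sup>2))) \<ge> 0"
    using t x by (intro mult_nonneg_nonneg[of "4 * x * t"]) auto
  moreover have "((t + x)\<^sup>2 + y\<^sup>2) * ((R\<^sup>2 - x * t)\<^sup>2 + (y * t)\<^sup>2)
      - ((R\<^sup>2 + x * t)\<^sup>2 + (y * t)\<^sup>2) * ((t - x)\<^sup>2 + y\<^sup>2)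
      = 4 * x * t * ((R\<^sup>2 - t\<^sup>2) * (R\<^sup>2 - (x\<^sup>2 + y\<^sup>2)))"
    by algebra
  ultimately have "((R\<^sup>2 + x * t)\<^sup>2 + (y * t)\<^sup>2) * ((t - x)\<^sup>2 + y\<^sup>2)
      \<le> ((t + x)\<^sup>2 + y\<^sup>2) * ((R\<^sup>2 - x * t)\<^sup>2 + (y * t)\<^sup>2)" by linarith
  then have "((R\<^sup>2 + x * t)\<^sup>2 + (y * t)\<^sup>2) / ((R\<^sup>2 - x * t)\<^sup>2 + (y * t)\<^sup>2)
      \<le> ((t + x)\<^sup>2 + y\<^sup>2) / ((t - x)\<^sup>2 + y\<^sup>2)"
    using p y by (subst frac_le_eq) (auto simp: sum_squares_pos sum_squares_pos' less_imp_neq[symmetric]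
        intro!: divide_nonpos_pos mult_pos_pos)
  then show ?thesis
    unfolding green_image_def green_log_def using p y
    by (subst ln_le_cancel_iff) (auto simp: sum_squares_pos sum_squares_pos')
qed

lemma green_image_le:
  assumes t: "0 \<le> t" "t \<le> N" and x: "0 < x" and N: "x * N < R\<^sup>2"
  shows "green_image R x y t \<le> 4 * x * N * R\<^sup>2 / (R\<^sup>2 - x * N)\<^sup>2"
proof -
  have xt: "x * t \<le> x * N" "0 \<le> x * t" using t x by auto
  let ?D = "(R\<^sup>2 - x * t)\<^sup>2 + (y * t)\<^sup>2"
  have D: "?D > 0" using xt N by (intro sum_squares_pos') linarith
  have num: "0 < (R\<^sup>2 + x * t)\<^sup>2 + (y * t)\<^sup>2" using xt N by (intro sum_squares_pos') linarith
  have "green_image R x y t \<le> ((R\<^sup>2 + x * t)\<^sup>2 + (y * t)\<^sup>2) / ?D - 1"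
    unfolding green_image_def using D num by (intro ln_le_minus_one) auto
  also have "\<dots> = 4 * (x * t) * R\<^sup>2 / ?D"
    using D by (simp add: field_simps power2_eq_square)
  also have "\<dots> \<le> 4 * (x * N) * R\<^sup>2 / (R\<^sup>2 - x * N)\<^sup>2"
  proof (rule frac_le)
    show "4 * (x * t) * R\<^sup>2 \<le> 4 * (x * N) * R\<^sup>2" using xt by (intro mult_right_mono) auto
    have "(R\<^sup>2 - x * N)\<^sup>2 \<le> (R\<^sup>2 - x * t)\<^sup>2" using xt N by (intro power_mono) auto
    then show "(R\<^sup>2 - x * N)\<^sup>2 \<le> ?D" by (simp add: add_increasing2)
  qed (use xt N in auto)
  finally show ?thesis by (simp add: mult.assoc)
qed

lemma green_difference_has_derivative:
  assumes t: "0 \<le> t" "t \<le> R" and x: "0 < x" "x < R" and y: "0 < y"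
  shows "((\<lambda>t. green_log x y t - green_image R x y t) has_real_derivative
           - Re (green_kernel R (Complex x y) (of_real t))) (at t)"
proof -
  let ?z = "Complex x y"
  note p = image_pos[OF t x]
  have pos: "(t + x)\<^sup>2 + y\<^sup>2 > 0" "(t - x)\<^sup>2 + y\<^sup>2 > 0"
    "(R\<^sup>2 + x * t)\<^sup>2 + (y * t)\<^sup>2 > 0" "(R\<^sup>2 - x * t)\<^sup>2 + (y * t)\<^sup>2 > 0"
    using y p by (auto simp: sum_squares_pos sum_squares_pos')
  have ne: "of_real t - ?z \<noteq> 0" "of_real t + ?z \<noteq> 0" using y by (auto simp: complex_eq_iff)
  have ne': "of_real (R\<^sup>2) - ?z * of_real t \<noteq> 0" "of_real (R\<^sup>2) + ?z * of_real t \<noteq> 0"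
    using p by (auto simp: complex_eq_iff simp del: of_real_power)
  have "(of_real t - ?z) * (of_real t + ?z) = (of_real t)\<^sup>2 - ?z\<^sup>2" by (simp add: algebra_simps power2_eq_square)
  then have 1: "2 * ?z / ((of_real t)\<^sup>2 - ?z\<^sup>2) = 1 / (of_real t - ?z) - 1 / (of_real t + ?z)"
    using ne by (simp add: diff_frac_eq)
  have "(of_real (R\<^sup>2) - ?z * of_real t) * (of_real (R\<^sup>2) + ?z * of_real t) = of_real (R ^ 4) - ?z\<^sup>2 * (of_real t)\<^sup>2"
    by (simp add: algebra_simps power2_eq_square power4_eq_xxxx)
  moreover have "?z / (of_real (R\<^sup>2) - ?z * of_real t) + ?z / (of_real (R\<^sup>2) + ?z * of_real t)
      = 2 * ?z * of_real (R\<^sup>2) / ((of_real (R\<^sup>2) - ?z * of_real t) * (of_real (R\<^sup>2) + ?z * of_real t))"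
    unfolding add_frac_eq[OF ne'] by (simp add: algebra_simps)
  ultimately have 2: "2 * ?z * of_real (R\<^sup>2) / (of_real (R ^ 4) - ?z\<^sup>2 * (of_real t)\<^sup>2)
      = ?z / (of_real (R\<^sup>2) - ?z * of_real t) + ?z / (of_real (R\<^sup>2) + ?z * of_real t)"
    by simp
  have "cnj (kernel_half R ?z (of_real t)) = kernel_half R (cnj ?z) (of_real t)"
    by (simp add: kernel_half_def)
  then have "Re (green_kernel R ?z (of_real t)) = 2 * Re (kernel_half R ?z (of_real t))"
    by (simp add: green_kernel_def complex_eq_iff)
  also have "Re (kernel_half R ?z (of_real t)) =
      (t - x) / ((t - x)\<^sup>2 + y\<^sup>2) - (t + x) / ((t + x)\<^sup>2 + y\<^sup>2)
    + (x * (R\<^sup>2 - x * t) - y * (y * t)) / ((R\<^sup>2 - x * t)\<^sup>2 + (y * t)\<^sup>2)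
    + (x * (R\<^sup>2 + x * t) + y * (y * t)) / ((R\<^sup>2 + x * t)\<^sup>2 + (y * t)\<^sup>2)"
    unfolding kernel_half_def 1 2 by (simp add: Re_divide)
  finally have K: "Re (green_kernel R ?z (of_real t)) = 2 * \<dots>" .
  have "((\<lambda>t. ln ((t + x)\<^sup>2 + y\<^sup>2) - ln ((t - x)\<^sup>2 + y\<^sup>2)
        - (ln ((R\<^sup>2 + x * t)\<^sup>2 + (y * t)\<^sup>2) - ln ((R\<^sup>2 - x * t)\<^sup>2 + (y * t)\<^sup>2))) has_real_derivative
        2 * (t + x) / ((t + x)\<^sup>2 + y\<^sup>2) - 2 * (t - x) / ((t - x)\<^sup>2 + y\<^sup>2)
        - ((2 * (R\<^sup>2 + x * t) * x + 2 * (y * t) * y) / ((R\<^sup>2 + x * t)\<^sup>2 + (y * t)\<^sup>2)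
        - (2 * (R\<^sup>2 - x * t) * (- x) + 2 * (y * t) * y) / ((R\<^sup>2 - x * t)\<^sup>2 + (y * t)\<^sup>2))) (at t)"
    using pos by (auto intro!: derivative_eq_intros) (simp add: algebra_simps)
  moreover have "2 * (t + x) / ((t + x)\<^sup>2 + y\<^sup>2) - 2 * (t - x) / ((t - x)\<^sup>2 + y\<^sup>2)
        - ((2 * (R\<^sup>2 + x * t) * x + 2 * (y * t) * y) / ((R\<^sup>2 + x * t)\<^sup>2 + (y * t)\<^sup>2)
        - (2 * (R\<^sup>2 - x * t) * (- x) + 2 * (y * t) * y) / ((R\<^sup>2 - x * t)\<^sup>2 + (y * t)\<^sup>2))
      = - Re (green_kernel R ?z (of_real t))"
    unfolding K by (simp add: add_divide_distrib diff_divide_distrib algebra_simps)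
  ultimately have D: "((\<lambda>t. ln ((t + x)\<^sup>2 + y\<^sup>2) - ln ((t - x)\<^sup>2 + y\<^sup>2)
        - (ln ((R\<^sup>2 + x * t)\<^sup>2 + (y * t)\<^sup>2) - ln ((R\<^sup>2 - x * t)\<^sup>2 + (y * t)\<^sup>2))) has_real_derivative
        - Re (green_kernel R ?z (of_real t))) (at t)" by (simp only:)
  define U where "U = {t. (R\<^sup>2 + x * t)\<^sup>2 + (y * t)\<^sup>2 > 0} \<inter> {t. (R\<^sup>2 - x * t)\<^sup>2 + (y * t)\<^sup>2 > 0}"
  have "open U" unfolding U_def by (intro open_Int open_Collect_less continuous_intros)
  moreover have "t \<in> U" using pos by (simp add: U_def)
  ultimately show ?thesis
    by (rule has_field_derivative_transform_within_open[OF D])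
      (use y in \<open>auto simp: U_def green_log_def green_image_def ln_div sum_squares_pos\<close>)
qed

text \<open>There are no boundary terms, because \<open>\<Gamma>\<close> vanishes at \<open>0\<close> and Green's function at \<open>R\<close>.\<close>

lemma green_difference_integration_by_parts:
  fixes g \<Gamma> :: "real \<Rightarrow> real"
  assumes x: "0 < x" "x < R" and y: "0 < y"
    and g: "continuous_on {0..R} g" and \<Gamma>: "continuous_on {0..R} \<Gamma>" "\<Gamma> 0 = 0"
    and der: "\<And>t. 0 < t \<Longrightarrow> t < R \<Longrightarrow> (\<Gamma> has_real_derivative g t) (at t)"
  shows "integral {0..R} (\<lambda>t. \<Gamma> t * Re (green_kernel R (Complex x y) (of_real t)))
       = integral {0..R} (\<lambda>t. (green_log x y t - green_image R x y t) * g t)"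
proof -
  define H where "H = (\<lambda>t. green_log x y t - green_image R x y t)"
  define k where "k = (\<lambda>t. Re (green_kernel R (Complex x y) (of_real t)))"
  have H': "(H has_real_derivative - k t) (at t)" if "t \<in> {0..R}" for t
    using green_difference_has_derivative[of t R x y] that x y by (simp add: H_def k_def)
  have contH: "continuous_on {0..R} H"
    using H' by (intro continuous_at_imp_continuous_on) (blast intro: DERIV_isCont)
  have HR: "H R = 0"
  proof -
    have "(R\<^sup>2 + x * R)\<^sup>2 + (y * R)\<^sup>2 = R\<^sup>2 * ((R + x)\<^sup>2 + y\<^sup>2)"
      "(R\<^sup>2 - x * R)\<^sup>2 + (y * R)\<^sup>2 = R\<^sup>2 * ((R - x)\<^sup>2 + y\<^sup>2)" by algebra+
    then show ?thesis using x by (simp add: H_def green_log_def green_image_def)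
  qed
  have "((\<lambda>t. g t * H t - \<Gamma> t * k t) has_integral (\<Gamma> R * H R - \<Gamma> 0 * H 0)) {0..R}"
  proof (rule fundamental_theorem_of_calculus_interior)
    show "((\<lambda>t. \<Gamma> t * H t) has_vector_derivative g t * H t - \<Gamma> t * k t) (at t)" if "t \<in> {0<..<R}" for t
      unfolding has_real_derivative_iff_has_vector_derivative[symmetric]
      using that by (auto intro!: derivative_eq_intros der H' simp: algebra_simps)
  qed (use x in \<open>auto intro!: continuous_intros \<Gamma> contH\<close>)
  then have 1: "((\<lambda>t. g t * H t - \<Gamma> t * k t) has_integral 0) {0..R}" by (simp add: HR \<Gamma>)
  have "((\<lambda>t. g t * H t) has_integral integral {0..R} (\<lambda>t. g t * H t)) {0..R}"
    by (intro integrable_integral integrable_continuous_interval continuous_intros g contH)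
  from has_integral_diff[OF this 1]
  have "((\<lambda>t. \<Gamma> t * k t) has_integral integral {0..R} (\<lambda>t. g t * H t)) {0..R}" by simp
  then show ?thesis by (simp add: integral_unique H_def k_def mult.commute)
qed

text \<open>The weight \<open>w * green_kernel R z w\<close> of the arc integral at \<open>w = p + \<i> q\<close> is \<open>x * p / R\<^sup>2\<close> times a factor that
  tends to \<open>8\<close> as \<open>R \<rightarrow> \<infinity>\<close>, uniformly on the arc. An estimate of the error by such a factor, rather than
  by an additive term, makes the contribution of the arc asymptotically proportional to \<open>x\<close>,
  whatever the growth of the solution.\<close>

lemma green_kernel_arc_explicit:
  assumes w: "p\<^sup>2 + q\<^sup>2 = R\<^sup>2" and R: "R > 0" and z: "x\<^sup>2 + y\<^sup>2 < R\<^sup>2"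
  defines "E \<equiv> (norm ((Complex p q)\<^sup>2 - (Complex x y)\<^sup>2))\<^sup>2"
    and "E' \<equiv> (norm ((Complex p q)\<^sup>2 - (Complex x (- y))\<^sup>2))\<^sup>2"
  shows "Re (Complex p q * green_kernel R (Complex x y) (Complex p q))
      = 4 * (R\<^sup>2 - (x\<^sup>2 + y\<^sup>2)) * (x * p) * ((E + E' + 16 * y\<^sup>2 * q\<^sup>2) / (E * E'))"
    and "(R\<^sup>2 - (x\<^sup>2 + y\<^sup>2))\<^sup>2 \<le> E" "E \<le> (R\<^sup>2 + (x\<^sup>2 + y\<^sup>2))\<^sup>2"
    and "(R\<^sup>2 - (x\<^sup>2 + y\<^sup>2))\<^sup>2 \<le> E'" "E' \<le> (R\<^sup>2 + (x\<^sup>2 + y\<^sup>2))\<^sup>2"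
proof -
  let ?w = "Complex p q" and ?z = "Complex x y"
  define r where "r = x\<^sup>2 + y\<^sup>2"
  have r: "r < R\<^sup>2" "r \<ge> 0" using z by (simp_all add: r_def)
  have nw: "norm ?w = R" using w R by (simp add: cmod_def)
  have nz: "norm ?z < R" using z R by (simp add: cmod_def real_less_lsqrt)
  have bounds: "(R\<^sup>2 - r)\<^sup>2 \<le> (norm (?w\<^sup>2 - v\<^sup>2))\<^sup>2 \<and> (norm (?w\<^sup>2 - v\<^sup>2))\<^sup>2 \<le> (R\<^sup>2 + r)\<^sup>2"
    if v: "(norm v)\<^sup>2 = r" for v :: complex
  proof -
    have "R\<^sup>2 - r \<le> norm (?w\<^sup>2 - v\<^sup>2)" "norm (?w\<^sup>2 - v\<^sup>2) \<le> R\<^sup>2 + r"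
      using norm_triangle_ineq2[of "?w\<^sup>2" "v\<^sup>2"] norm_triangle_ineq4[of "?w\<^sup>2" "v\<^sup>2"] v nw
      by (simp_all add: norm_power)
    then show ?thesis using r by (auto intro!: power_mono)
  qed
  have E: "(R\<^sup>2 - r)\<^sup>2 \<le> E \<and> E \<le> (R\<^sup>2 + r)\<^sup>2" unfolding E_def
    by (rule bounds) (simp add: cmod_def r_def)
  have E': "(R\<^sup>2 - r)\<^sup>2 \<le> E' \<and> E' \<le> (R\<^sup>2 + r)\<^sup>2" unfolding E'_def
    by (rule bounds) (simp add: cmod_def r_def)
  show "(R\<^sup>2 - (x\<^sup>2 + y\<^sup>2))\<^sup>2 \<le> E" "E \<le> (R\<^sup>2 + (x\<^sup>2 + y\<^sup>2))\<^sup>2"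
    "(R\<^sup>2 - (x\<^sup>2 + y\<^sup>2))\<^sup>2 \<le> E'" "E' \<le> (R\<^sup>2 + (x\<^sup>2 + y\<^sup>2))\<^sup>2"
    using E E' by (simp_all add: r_def)
  have "(R\<^sup>2 - r)\<^sup>2 > 0" using r by simp
  with E E' have pos: "E > 0" "E' > 0" by linarith+
  have half: "Re (2 * v * ?w / (?w\<^sup>2 - v\<^sup>2)) = 2 * (R\<^sup>2 - r) * (Re v * p + Im v * q) / (norm (?w\<^sup>2 - v\<^sup>2))\<^sup>2"
    if v: "(norm v)\<^sup>2 = r" for v :: complex
  proof -
    have v': "(Re v)\<^sup>2 + (Im v)\<^sup>2 = r" using v by (simp add: cmod_power2)
    have "Re (2 * v * ?w / (?w\<^sup>2 - v\<^sup>2))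
        = Re (2 * v * ?w * cnj (?w\<^sup>2 - v\<^sup>2)) / (norm (?w\<^sup>2 - v\<^sup>2))\<^sup>2"
      by (subst complex_div_cnj) (simp add: Re_divide_of_real flip: of_real_power)
    also have "Re (2 * v * ?w * cnj (?w\<^sup>2 - v\<^sup>2))
        = 2 * ((p\<^sup>2 + q\<^sup>2) - ((Re v)\<^sup>2 + (Im v)\<^sup>2)) * (Re v * p + Im v * q)"
      by (simp add: Re_power2 Im_power2) (simp add: algebra_simps power2_eq_square)
    finally show ?thesis by (simp only: w v')
  qed
  have "Re (?w * green_kernel R ?z ?w)
      = 2 * Re (2 * ?z * ?w / (?w\<^sup>2 - ?z\<^sup>2) + 2 * cnj ?z * ?w / (?w\<^sup>2 - (cnj ?z)\<^sup>2))"
    by (subst green_kernel_arc[OF nw nz]) simp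
  also have "\<dots> = 2 * (2 * (R\<^sup>2 - r) * (x * p + y * q) / E + 2 * (R\<^sup>2 - r) * (x * p - y * q) / E')"
    using half[of ?z] half[of "cnj ?z"] by (simp add: E_def E'_def cmod_def r_def complex_cnj)
  also have "\<dots> = 4 * (R\<^sup>2 - r) * (x * p * (E + E') + y * q * (E' - E)) / (E * E')"
    using pos by (simp add: field_simps)
  also have "E' - E = 16 * x * y * p * q"
    unfolding E_def E'_def by (simp add: cmod_power2 Re_power2 Im_power2) algebra
  also have "x * p * (E + E') + y * q * (16 * x * y * p * q) = x * p * (E + E' + 16 * y\<^sup>2 * q\<^sup>2)" by algebra
  finally show "Re (?w * green_kernel R ?z ?w)
      = 4 * (R\<^sup>2 - (x\<^sup>2 + y\<^sup>2)) * (x * p) * ((E + E' + 16 * y\<^sup>2 * q\<^sup>2) / (E * E'))"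
    by (simp add: r_def mult.assoc)
qed

text \<open>The bounds for this factor, with \<open>r = x\<^sup>2 + y\<^sup>2\<close>.\<close>

definition arc_lower :: "real \<Rightarrow> real \<Rightarrow> real" where
  "arc_lower r R = 8 * R\<^sup>2 * (R\<^sup>2 - r) / (R\<^sup>2 + r)\<^sup>2"

definition arc_upper :: "real \<Rightarrow> real \<Rightarrow> real" where
  "arc_upper r R = 4 * R\<^sup>2 * (R\<^sup>2 - r) * (2 / (R\<^sup>2 - r)\<^sup>2 + 16 * r * R\<^sup>2 / (R\<^sup>2 - r) ^ 4)"

lemma arc_lower_tendsto: "(arc_lower r \<longlongrightarrow> 8) at_top"
  unfolding arc_lower_def by real_asymp

lemma arc_upper_tendsto: "(arc_upper r \<longlongrightarrow> 8) at_top"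
  unfolding arc_upper_def by real_asymp

lemma green_kernel_arc_bounds:
  assumes w: "p\<^sup>2 + q\<^sup>2 = R\<^sup>2" and R: "R > 0" and z: "x\<^sup>2 + y\<^sup>2 < R\<^sup>2" and p: "p \<ge> 0" and x: "x > 0"
  shows "arc_lower (x\<^sup>2 + y\<^sup>2) R * (x * p / R\<^sup>2) \<le> Re (Complex p q * green_kernel R (Complex x y) (Complex p q))"
    and "Re (Complex p q * green_kernel R (Complex x y) (Complex p q)) \<le> arc_upper (x\<^sup>2 + y\<^sup>2) R * (x * p / R\<^sup>2)"
proof -
  define r where "r = x\<^sup>2 + y\<^sup>2"
  define E where "E = (norm ((Complex p q)\<^sup>2 - (Complex x y)\<^sup>2))\<^sup>2"
  define E' where "E' = (norm ((Complex p q)\<^sup>2 - (Complex x (- y))\<^sup>2))\<^sup>2"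
  note ex = green_kernel_arc_explicit[OF w R z, folded E_def E'_def r_def]
  have r: "r < R\<^sup>2" "r \<ge> 0" "y\<^sup>2 \<le> r" using z by (simp_all add: r_def)
  have "q\<^sup>2 \<le> R\<^sup>2" using w by (metis le_add_same_cancel2 zero_le_power2)
  have "(R\<^sup>2 - r)\<^sup>2 > 0" using r by simp
  then have pos: "E > 0" "E' > 0" using ex by linarith+
  have split: "(E + E' + 16 * y\<^sup>2 * q\<^sup>2) / (E * E') = 1 / E + 1 / E' + 16 * y\<^sup>2 * q\<^sup>2 / (E * E')"
    using pos by (simp add: field_simps)
  define c where "c = 4 * (R\<^sup>2 - r) * (x * p)"
  have c: "c \<ge> 0" using r p x by (simp add: c_def)
  have K: "Re (Complex p q * green_kernel R (Complex x y) (Complex p q))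
      = c * (1 / E + 1 / E' + 16 * y\<^sup>2 * q\<^sup>2 / (E * E'))"
    unfolding ex(1) split c_def ..
  have "1 / (R\<^sup>2 + r)\<^sup>2 \<le> 1 / E" "1 / (R\<^sup>2 + r)\<^sup>2 \<le> 1 / E'"
    using ex(3,5) pos by (intro frac_le; simp)+
  moreover have "0 \<le> 16 * y\<^sup>2 * q\<^sup>2 / (E * E')" using pos by simp
  ultimately have "2 / (R\<^sup>2 + r)\<^sup>2 \<le> 1 / E + 1 / E' + 16 * y\<^sup>2 * q\<^sup>2 / (E * E')" by simp
  then have "c * (2 / (R\<^sup>2 + r)\<^sup>2) \<le> c * (1 / E + 1 / E' + 16 * y\<^sup>2 * q\<^sup>2 / (E * E'))"
    using c by (rule mult_left_mono)
  moreover have "c * (2 / (R\<^sup>2 + r)\<^sup>2) = arc_lower (x\<^sup>2 + y\<^sup>2) R * (x * p / R\<^sup>2)"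
    unfolding arc_lower_def r_def[symmetric] c_def using R by simp
  ultimately show "arc_lower (x\<^sup>2 + y\<^sup>2) R * (x * p / R\<^sup>2) \<le> Re (Complex p q * green_kernel R (Complex x y) (Complex p q))"
    unfolding K by simp
  have inv: "1 / E \<le> 1 / (R\<^sup>2 - r)\<^sup>2" "1 / E' \<le> 1 / (R\<^sup>2 - r)\<^sup>2"
    using ex(2,4) \<open>(R\<^sup>2 - r)\<^sup>2 > 0\<close> by (intro frac_le; simp)+
  have "16 * y\<^sup>2 * q\<^sup>2 / (E * E') \<le> 16 * r * R\<^sup>2 / ((R\<^sup>2 - r)\<^sup>2 * (R\<^sup>2 - r)\<^sup>2)"
    using ex(2,4) \<open>(R\<^sup>2 - r)\<^sup>2 > 0\<close> r \<open>q\<^sup>2 \<le> R\<^sup>2\<close>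
    by (intro frac_le mult_mono less_imp_le[OF pos(1)]) auto
  also have "(R\<^sup>2 - r)\<^sup>2 * (R\<^sup>2 - r)\<^sup>2 = (R\<^sup>2 - r) ^ 4" by (simp flip: power_add)
  finally have "1 / E + 1 / E' + 16 * y\<^sup>2 * q\<^sup>2 / (E * E')
      \<le> 2 / (R\<^sup>2 - r)\<^sup>2 + 16 * r * R\<^sup>2 / (R\<^sup>2 - r) ^ 4"
    using inv by simp
  then have "c * (1 / E + 1 / E' + 16 * y\<^sup>2 * q\<^sup>2 / (E * E'))
      \<le> c * (2 / (R\<^sup>2 - r)\<^sup>2 + 16 * r * R\<^sup>2 / (R\<^sup>2 - r) ^ 4)"
    using c by (rule mult_left_mono)
  also have "\<dots> = arc_upper (x\<^sup>2 + y\<^sup>2) R * (x * p / R\<^sup>2)"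
    unfolding arc_upper_def r_def[symmetric] c_def using R by simp
  finally show "Re (Complex p q * green_kernel R (Complex x y) (Complex p q)) \<le> arc_upper (x\<^sup>2 + y\<^sup>2) R * (x * p / R\<^sup>2)"
    unfolding K .
qed

lemma mono_bounded_tendsto_Sup:
  fixes K :: "real \<Rightarrow> real"
  assumes mono: "\<And>s t. 0 \<le> s \<Longrightarrow> s \<le> t \<Longrightarrow> K s \<le> K t" and bdd: "\<And>t. 0 \<le> t \<Longrightarrow> K t \<le> B"
  shows "(K \<longlongrightarrow> (SUP t\<in>{0..}. K t)) at_top"
    and "\<And>t. 0 \<le> t \<Longrightarrow> K t \<le> (SUP t\<in>{0..}. K t)"
proof -
  have bd: "bdd_above (K ` {0..})" using bdd by (auto intro!: bdd_aboveI[of _ B])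
  show le: "K t \<le> (SUP t\<in>{0..}. K t)" if "0 \<le> t" for t
    using that bd by (intro cSUP_upper) auto
  show "(K \<longlongrightarrow> (SUP t\<in>{0..}. K t)) at_top"
  proof (rule order_tendstoI)
    fix a assume "a < (SUP t\<in>{0..}. K t)"
    then obtain t where t: "t \<ge> 0" "a < K t" using bd by (subst (asm) less_cSUP_iff) auto
    show "\<forall>\<^sub>F s in at_top. a < K s"
      using eventually_ge_at_top[of t] by eventually_elim (use t mono in \<open>auto intro: less_le_trans\<close>)
  next
    fix a assume a: "(SUP t\<in>{0..}. K t) < a"
    show "\<forall>\<^sub>F s in at_top. K s < a"
      using eventually_ge_at_top[of 0] by eventually_elim (use le a in \<open>auto intro: le_less_trans\<close>)
  qed
qed

text \<open>The Riesz-Herglotz representation of \<open>Re \<Phi>\<close>. As \<open>R \<rightarrow> \<infinity>\<close> the integrals over the real axis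
  converge because they are bounded by the value of the nonnegative function \<open>Re \<Phi>\<close>; the
  arc integrals converge in consequence, and by the form of the kernel on the arc their limit is a
  multiple of \<open>x\<close>.\<close>

theorem green_representation:
  fixes \<Phi> :: "complex \<Rightarrow> complex" and g :: "real \<Rightarrow> real"
  assumes cont: "continuous_on closed_quadrant \<Phi>" and hol: "\<Phi> holomorphic_on open_quadrant"
    and \<Phi>0: "\<Phi> 0 = 0"
    and nonneg: "\<And>z. z \<in> closed_quadrant \<Longrightarrow> Re (\<Phi> z) \<ge> 0"
    and imag: "\<And>y. y \<ge> 0 \<Longrightarrow> Re (\<Phi> (\<i> * of_real y)) = 0"
    and g: "continuous_on {0..} g" "\<And>t. t \<ge> 0 \<Longrightarrow> g t \<ge> 0"
    and der: "\<And>t. t > 0 \<Longrightarrow> ((\<lambda>t. Im (\<Phi> (of_real t))) has_real_derivative g t) (at t)"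
  obtains q where "q \<ge> 0"
    "\<And>x y. x > 0 \<Longrightarrow> y > 0 \<Longrightarrow>
       ((\<lambda>N. integral {0..N} (\<lambda>t. green_log x y t * g t)) \<longlongrightarrow> 2 * pi * Re (\<Phi> (Complex x y)) - q * x) at_top"
proof -
  define U where "U = (\<lambda>x y. 2 * pi * Re (\<Phi> (Complex x y)))"
  define K where "K = (\<lambda>x y N. integral {0..N} (\<lambda>t. green_log x y t * g t))"
  define J where "J = (\<lambda>x y R N. integral {0..N} (\<lambda>t. (green_log x y t - green_image R x y t) * g t))"
  define A where "A = (\<lambda>x y R. integral {0..pi / 2} (\<lambda>\<theta>. Re (\<Phi> (of_real R * cis \<theta>))
          * Re (of_real R * cis \<theta> * green_kernel R (Complex x y) (of_real R * cis \<theta>))))"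
  define Q where "Q = (\<lambda>R. integral {0..pi / 2} (\<lambda>\<theta>. Re (\<Phi> (of_real R * cis \<theta>)) * cos \<theta>) / R)"
  have gc: "continuous_on S g" if "S \<subseteq> {0..}" for S using g(1) that by (rule continuous_on_subset)
  have U_eq: "U x y = J x y R R + A x y R"
    if x: "x > 0" and y: "y > 0" and R: "x\<^sup>2 + y\<^sup>2 < R\<^sup>2" "R > 0" for x y R
  proof -
    have xR: "x < R"
    proof (rule power2_less_imp_less)
      show "x\<^sup>2 < R\<^sup>2" using R zero_le_power2[of y] by linarith
    qed (use R in auto)
    have nz: "norm (Complex x y) < R" using R by (simp add: cmod_def real_less_lsqrt)
    have "integral {0..R} (\<lambda>t. Im (\<Phi> (of_real t)) * Re (green_kernel R (Complex x y) (of_real t))) = J x y R R"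
      unfolding J_def
    proof (rule green_difference_integration_by_parts[OF x xR y])
      show "continuous_on {0..R} (\<lambda>t. Im (\<Phi> (of_real t)))"
        by (intro continuous_intros continuous_on_compose2[OF cont]) auto
    qed (use gc der \<Phi>0 in auto)
    then show ?thesis
      unfolding U_def A_def using cauchy_quarter_disc[OF cont hol imag _ _ nz] x y by simp
  qed
  have arc_cont: "continuous_on {0..pi / 2} (\<lambda>\<theta>. Re (\<Phi> (of_real R * cis \<theta>)))" if "R > 0" for R
    using that by (intro continuous_intros continuous_on_compose2[OF cont])
      (auto intro!: mult_nonneg_nonneg cos_ge_zero sin_ge_zero)
  have arc_nonneg: "Re (\<Phi> (of_real R * cis \<theta>)) \<ge> 0" if "R > 0" "\<theta> \<in> {0..pi / 2}" for R \<theta>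
    using that by (intro nonneg) (auto intro!: mult_nonneg_nonneg cos_ge_zero sin_ge_zero)
  have arc_cos: "continuous_on {0..pi / 2} (\<lambda>\<theta>. Re (\<Phi> (of_real R * cis \<theta>)) * cos \<theta>)" if "R > 0" for R
    by (rule continuous_on_mult[OF arc_cont[OF that]]) (intro continuous_intros)
  have Q_nonneg: "Q R \<ge> 0" if "R > 0" for R
    unfolding Q_def
  proof (rule divide_nonneg_pos[OF integral_nonneg that])
    show "0 \<le> Re (\<Phi> (of_real R * cis \<theta>)) * cos \<theta>" if "\<theta> \<in> {0..pi / 2}" for \<theta>
      using that arc_nonneg[OF \<open>R > 0\<close> that] by (intro mult_nonneg_nonneg cos_ge_zero) auto
  qed (rule integrable_continuous_interval[OF arc_cos[OF that]])
  have A_bounds: "arc_lower (x\<^sup>2 + y\<^sup>2) R * (x * Q R) \<le> A x y R \<and> A x y R \<le> arc_upper (x\<^sup>2 + y\<^sup>2) R * (x * Q R)"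
    if x: "x > 0" and y: "y > 0" and R: "x\<^sup>2 + y\<^sup>2 < R\<^sup>2" "R > 0" for x y R
  proof -
    let ?u = "\<lambda>\<theta>. Re (\<Phi> (of_real R * cis \<theta>))"
    let ?P = "\<lambda>\<theta>. Re (of_real R * cis \<theta> * green_kernel R (Complex x y) (of_real R * cis \<theta>))"
    have nz: "norm (Complex x y) < R" using R by (simp add: cmod_def real_less_lsqrt)
    have ker: "arc_lower (x\<^sup>2 + y\<^sup>2) R * (x / R) * cos \<theta> \<le> ?P \<theta>"
       "?P \<theta> \<le> arc_upper (x\<^sup>2 + y\<^sup>2) R * (x / R) * cos \<theta>" if "\<theta> \<in> {0..pi / 2}" for \<theta>
    proof -
      have w: "of_real R * cis \<theta> = Complex (R * cos \<theta>) (R * sin \<theta>)" by (simp add: complex_eq_iff)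
      have n: "(R * cos \<theta>)\<^sup>2 + (R * sin \<theta>)\<^sup>2 = R\<^sup>2"
        by (simp add: power_mult_distrib flip: distrib_left)
      have p: "R * cos \<theta> \<ge> 0" using that R by (auto intro!: mult_nonneg_nonneg cos_ge_zero)
      have "x * (R * cos \<theta>) / R\<^sup>2 = (x / R) * cos \<theta>" using R by (simp add: power2_eq_square)
      then show "arc_lower (x\<^sup>2 + y\<^sup>2) R * (x / R) * cos \<theta> \<le> ?P \<theta>"
         "?P \<theta> \<le> arc_upper (x\<^sup>2 + y\<^sup>2) R * (x / R) * cos \<theta>"
        using green_kernel_arc_bounds[OF n R(2) R(1) p x] unfolding w by (simp_all add: mult.assoc)
    qed
    have ne: "of_real R * cis \<theta> \<noteq> v" if "norm v < R" for v \<theta>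
      using that R by (auto simp: norm_mult)
    have Pc: "continuous_on {0..pi / 2} ?P"
    proof -
      have "continuous_on {0..pi / 2} (\<lambda>\<theta>. 2 * Re (2 * Complex x y * (of_real R * cis \<theta>) / ((of_real R * cis \<theta>)\<^sup>2 - (Complex x y)\<^sup>2)
          + 2 * cnj (Complex x y) * (of_real R * cis \<theta>) / ((of_real R * cis \<theta>)\<^sup>2 - (cnj (Complex x y))\<^sup>2)))"
        using nz ne[of "Complex x y"] ne[of "- Complex x y"] ne[of "cnj (Complex x y)"] ne[of "- cnj (Complex x y)"]
        by (intro continuous_intros) (auto simp: power2_eq_iff simp del: complex_cnj)
      moreover have "?P \<theta> = 2 * Re (2 * Complex x y * (of_real R * cis \<theta>) / ((of_real R * cis \<theta>)\<^sup>2 - (Complex x y)\<^sup>2)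
          + 2 * cnj (Complex x y) * (of_real R * cis \<theta>) / ((of_real R * cis \<theta>)\<^sup>2 - (cnj (Complex x y))\<^sup>2))" for \<theta>
      proof -
        have "norm (of_real R * cis \<theta>) = R" using R by (simp add: norm_mult)
        from green_kernel_arc[OF this nz] show ?thesis by simp
      qed
      ultimately show ?thesis by simp
    qed
    have ints: "(\<lambda>\<theta>. ?u \<theta> * ?P \<theta>) integrable_on {0..pi / 2}"
      "(\<lambda>\<theta>. c * (?u \<theta> * cos \<theta>)) integrable_on {0..pi / 2}" for c
      by (rule integrable_continuous_interval continuous_on_mult continuous_on_const arc_cont Pc arc_cos R)+
    have "arc_lower (x\<^sup>2 + y\<^sup>2) R * (x * Q R)
        = integral {0..pi / 2} (\<lambda>\<theta>. arc_lower (x\<^sup>2 + y\<^sup>2) R * (x / R) * (?u \<theta> * cos \<theta>))"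
      by (simp add: Q_def)
    also have "\<dots> \<le> A x y R"
      unfolding A_def
    proof (rule integral_le)
      show "arc_lower (x\<^sup>2 + y\<^sup>2) R * (x / R) * (?u \<theta> * cos \<theta>) \<le> ?u \<theta> * ?P \<theta>" if "\<theta> \<in> {0..pi / 2}" for \<theta>
        using mult_left_mono[OF ker(1)[OF that] arc_nonneg[OF R(2) that]] by (simp add: mult_ac)
    qed (rule ints)+
    finally have 1: "arc_lower (x\<^sup>2 + y\<^sup>2) R * (x * Q R) \<le> A x y R" .
    have "A x y R \<le> integral {0..pi / 2} (\<lambda>\<theta>. arc_upper (x\<^sup>2 + y\<^sup>2) R * (x / R) * (?u \<theta> * cos \<theta>))"
      unfolding A_def
    proof (rule integral_le)
      show "?u \<theta> * ?P \<theta> \<le> arc_upper (x\<^sup>2 + y\<^sup>2) R * (x / R) * (?u \<theta> * cos \<theta>)" if "\<theta> \<in> {0..pi / 2}" for \<theta>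
        using mult_left_mono[OF ker(2)[OF that] arc_nonneg[OF R(2) that]] by (simp add: mult_ac)
    qed (rule ints)+
    also have "\<dots> = arc_upper (x\<^sup>2 + y\<^sup>2) R * (x * Q R)"
      by (simp add: Q_def)
    finally show ?thesis using 1 by simp
  qed
  have big: "\<forall>\<^sub>F R in at_top. x\<^sup>2 + y\<^sup>2 < R\<^sup>2 \<and> R > 0 \<and> arc_lower (x\<^sup>2 + y\<^sup>2) R > 0 \<and> arc_upper (x\<^sup>2 + y\<^sup>2) R > 0" for x y :: real
  proof -
    have "filterlim (\<lambda>R::real. R\<^sup>2) at_top at_top" by real_asymp
    then have "\<forall>\<^sub>F R in at_top. x\<^sup>2 + y\<^sup>2 < (R::real)\<^sup>2" by (simp add: filterlim_at_top_dense)
    moreover have "\<forall>\<^sub>F R in at_top. arc_lower (x\<^sup>2 + y\<^sup>2) R > 0" "\<forall>\<^sub>F R in at_top. arc_upper (x\<^sup>2 + y\<^sup>2) R > 0"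
      using order_tendstoD(1)[OF arc_lower_tendsto, of 0] order_tendstoD(1)[OF arc_upper_tendsto, of 0] by auto
    ultimately show ?thesis using eventually_gt_at_top[of "0::real"] by eventually_elim auto
  qed
  have image_cont: "continuous_on {0..N} (green_image R x y)" if "0 < x" "x * N < R\<^sup>2" for R x y N
  proof -
    have "R\<^sup>2 - x * t > 0 \<and> R\<^sup>2 + x * t > 0" if t: "t \<in> {0..N}" for t
    proof -
      have "0 \<le> x * t" "x * t \<le> x * N" using t \<open>0 < x\<close> by auto
      then show ?thesis using \<open>x * N < R\<^sup>2\<close> by auto
    qed
    then show ?thesis unfolding green_image_def
      by (intro continuous_intros) (auto simp: sum_squares_pos' less_imp_neq[symmetric])
  qed
  have J_le: "J x y R N \<le> J x y R R" "J x y R R \<le> K x y R"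
    if x: "x > 0" and y: "y > 0" and R: "x\<^sup>2 + y\<^sup>2 < R\<^sup>2" "R > 0" and N: "0 \<le> N" "N \<le> R" for x y R N
  proof -
    have xR: "x < R"
    proof (rule power2_less_imp_less)
      show "x\<^sup>2 < R\<^sup>2" using R zero_le_power2[of y] by linarith
    qed (use R in auto)
    have c: "continuous_on {0..R} (green_image R x y)" using xR x R by (intro image_cont) (auto simp: power2_eq_square)
    have i: "(\<lambda>t. (green_log x y t - green_image R x y t) * g t) integrable_on {0..R}"
      by (intro integrable_continuous_interval continuous_intros c continuous_on_green_log y gc) auto
    show "J x y R N \<le> J x y R R"
      unfolding J_def
    proof (rule integral_subset_le)
      show "(\<lambda>t. (green_log x y t - green_image R x y t) * g t) integrable_on {0..N}"
        using N by (intro integrable_subinterval_real[OF i]) auto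
      show "\<forall>t\<in>{0..R}. 0 \<le> (green_log x y t - green_image R x y t) * g t"
        using green_image_le_green_log[of _ R x y] x y R g(2) by auto
    qed (use i N in auto)
    show "J x y R R \<le> K x y R"
      unfolding J_def K_def
    proof (rule integral_le[OF i])
      show "(\<lambda>t. green_log x y t * g t) integrable_on {0..R}"
        by (intro integrable_continuous_interval continuous_on_green_log_mult y gc) auto
      show "(green_log x y t - green_image R x y t) * g t \<le> green_log x y t * g t" if "t \<in> {0..R}" for t
        using green_image_nonneg[of t R x y] that x xR g(2)[of t] by (intro mult_right_mono) auto
    qed
  qed
  have K_int: "(\<lambda>t. green_log x y t * g t) integrable_on {0..N}" if "y > 0" for x y N
    by (intro integrable_continuous_interval continuous_on_green_log_mult that gc) auto
  have J_lim: "((\<lambda>R. J x y R N) \<longlongrightarrow> K x y N) at_top" if x: "x > 0" and y: "y > 0" and N: "N \<ge> 0" for x y N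
  proof -
    define e where "e = (\<lambda>R. (x * N) * (4 * R\<^sup>2 / (R\<^sup>2 - x * N)\<^sup>2) * integral {0..N} g)"
    have "((\<lambda>R. 4 * R\<^sup>2 / (R\<^sup>2 - c)\<^sup>2) \<longlongrightarrow> 0) at_top" for c :: real by real_asymp
    then have "(e \<longlongrightarrow> (x * N) * 0 * integral {0..N} g) at_top"
      unfolding e_def by (intro tendsto_intros)
    then have "((\<lambda>R. K x y N - e R) \<longlongrightarrow> K x y N - 0) at_top" by (intro tendsto_intros) simp
    then have lower: "((\<lambda>R. K x y N - e R) \<longlongrightarrow> K x y N) at_top" by simp
    have ev: "\<forall>\<^sub>F R in at_top. x * N < (R::real)\<^sup>2 \<and> x < R \<and> N \<le> R"
    proof -
      have "filterlim (\<lambda>R::real. R\<^sup>2) at_top at_top" by real_asymp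
      then have "\<forall>\<^sub>F R in at_top. x * N < (R::real)\<^sup>2" by (simp add: filterlim_at_top_dense)
      then show ?thesis using eventually_gt_at_top[of x] eventually_ge_at_top[of N] by eventually_elim auto
    qed
    have bounds: "K x y N - e R \<le> J x y R N \<and> J x y R N \<le> K x y N" if R: "x * N < R\<^sup>2 \<and> x < R \<and> N \<le> R" for R
    proof -
      have c: "continuous_on {0..N} (green_image R x y)" using x R by (intro image_cont) auto
      have ii: "(\<lambda>t. green_image R x y t * g t) integrable_on {0..N}"
        by (intro integrable_continuous_interval continuous_intros c gc) auto
      have "J x y R N = K x y N - integral {0..N} (\<lambda>t. green_image R x y t * g t)"
        unfolding J_def K_def
        using Henstock_Kurzweil_Integration.integral_diff[OF K_int[OF y, of x N] ii] by (simp add: left_diff_distrib)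
      moreover have "integral {0..N} (\<lambda>t. green_image R x y t * g t) \<ge> 0"
      proof (rule integral_nonneg[OF ii])
        show "0 \<le> green_image R x y t * g t" if "t \<in> {0..N}" for t
          using green_image_nonneg[of t R x y] g(2)[of t] that R x by auto
      qed
      moreover have "integral {0..N} (\<lambda>t. green_image R x y t * g t)
          \<le> integral {0..N} (\<lambda>t. (4 * x * N * R\<^sup>2 / (R\<^sup>2 - x * N)\<^sup>2) * g t)"
      proof (rule integral_le[OF ii])
        show "green_image R x y t * g t \<le> (4 * x * N * R\<^sup>2 / (R\<^sup>2 - x * N)\<^sup>2) * g t" if "t \<in> {0..N}" for t
          using green_image_le[of t N x R y] g(2)[of t] that R x by (intro mult_right_mono) auto
      qed (intro integrable_continuous_interval continuous_intros gc, auto)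
      moreover have "integral {0..N} (\<lambda>t. (4 * x * N * R\<^sup>2 / (R\<^sup>2 - x * N)\<^sup>2) * g t) = e R"
        by (simp add: e_def mult_ac)
      ultimately show ?thesis by linarith
    qed
    show ?thesis
      by (rule tendsto_sandwich[OF _ _ lower tendsto_const]; use ev in eventually_elim) (use bounds in auto)
  qed
  have K_mono: "K x y s \<le> K x y t" if "x > 0" "y > 0" "0 \<le> s" "s \<le> t" for x y s t
    unfolding K_def
    by (rule integral_subset_le) (use that K_int g(2) green_log_nonneg in auto)
  have K_le: "K x y N \<le> U x y" if x: "x > 0" and y: "y > 0" and N: "N \<ge> 0" for x y N
  proof (rule tendsto_upperbound[OF J_lim[OF x y N]])
    show "\<forall>\<^sub>F R in at_top. J x y R N \<le> U x y"
      using big[of x y] eventually_ge_at_top[of N]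
    proof eventually_elim
      case (elim R)
      then have R: "x\<^sup>2 + y\<^sup>2 < R\<^sup>2" "R > 0" by auto
      have "0 \<le> arc_lower (x\<^sup>2 + y\<^sup>2) R * (x * Q R)" using elim x Q_nonneg[of R] by (intro mult_nonneg_nonneg) auto
      then show ?case using U_eq[OF x y R] A_bounds[OF x y R] J_le(1)[OF x y R N] elim by linarith
    qed
  qed simp
  define S where "S = (\<lambda>x y. SUP N\<in>{0..}. K x y N)"
  have K_S: "(K x y \<longlongrightarrow> S x y) at_top" "\<And>N. N \<ge> 0 \<Longrightarrow> K x y N \<le> S x y" if "x > 0" "y > 0" for x y
    unfolding S_def
    using mono_bounded_tendsto_Sup[of "K x y" "U x y"] K_mono[OF that] K_le[OF that] by auto
  have J_S: "((\<lambda>R. J x y R R) \<longlongrightarrow> S x y) at_top" if x: "x > 0" and y: "y > 0" for x y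
  proof (rule order_tendstoI)
    fix a assume "a < S x y"
    then have "\<forall>\<^sub>F N in at_top. a < K x y N \<and> N \<ge> 0"
      using order_tendstoD(1)[OF K_S(1)[OF x y]] eventually_ge_at_top[of 0] by (intro eventually_conj) auto
    then obtain N where N: "a < K x y N" "N \<ge> 0" using eventually_happens by force
    show "\<forall>\<^sub>F R in at_top. a < J x y R R"
      using order_tendstoD(1)[OF J_lim[OF x y N(2)] N(1)] big[of x y] eventually_ge_at_top[of N]
    proof eventually_elim
      case (elim R)
      then show ?case using J_le(1)[OF x y, of R N] N by auto
    qed
  next
    fix a assume "S x y < a"
    show "\<forall>\<^sub>F R in at_top. J x y R R < a"
      using big[of x y]
    proof eventually_elim
      case (elim R)
      then show ?case using J_le(2)[OF x y, of R 0] K_S(2)[OF x y, of R] \<open>S x y < a\<close> by auto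
    qed
  qed
  have Q_lim: "(Q \<longlongrightarrow> (U x y - S x y) / (8 * x)) at_top" if x: "x > 0" and y: "y > 0" for x y
  proof -
    have "((\<lambda>R. U x y - J x y R R) \<longlongrightarrow> U x y - S x y) at_top" by (intro tendsto_intros J_S x y)
    then have A_lim: "(A x y \<longlongrightarrow> U x y - S x y) at_top"
      by (rule Lim_transform_eventually) (use big[of x y] in \<open>eventually_elim, use U_eq[OF x y] in auto\<close>)
    show ?thesis
    proof (rule tendsto_sandwich)
      show "((\<lambda>R. A x y R / (arc_upper (x\<^sup>2 + y\<^sup>2) R * x)) \<longlongrightarrow> (U x y - S x y) / (8 * x)) at_top"
        "((\<lambda>R. A x y R / (arc_lower (x\<^sup>2 + y\<^sup>2) R * x)) \<longlongrightarrow> (U x y - S x y) / (8 * x)) at_top"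
        using x by (auto intro!: tendsto_intros A_lim arc_upper_tendsto arc_lower_tendsto)
      show "\<forall>\<^sub>F R in at_top. A x y R / (arc_upper (x\<^sup>2 + y\<^sup>2) R * x) \<le> Q R"
        using big[of x y] by eventually_elim (use A_bounds[OF x y] x in \<open>auto simp: pos_divide_le_eq mult_ac\<close>)
      show "\<forall>\<^sub>F R in at_top. Q R \<le> A x y R / (arc_lower (x\<^sup>2 + y\<^sup>2) R * x)"
        using big[of x y] by eventually_elim (use A_bounds[OF x y] x in \<open>auto simp: pos_le_divide_eq mult_ac\<close>)
    qed
  qed
  define q where "q = U 1 1 - S 1 1"
  show thesis
  proof (rule that[of q])
    have "\<forall>\<^sub>F R in at_top. 0 \<le> Q R"
      using eventually_gt_at_top[of "0::real"] by eventually_elim (rule Q_nonneg)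
    then show "q \<ge> 0"
      using tendsto_lowerbound[OF Q_lim[of 1 1], of 0]
      by (simp add: q_def)
    fix x y :: real assume xy: "x > 0" "y > 0"
    have "(U x y - S x y) / (8 * x) = (U 1 1 - S 1 1) / (8 * 1)"
      using tendsto_unique[OF _ Q_lim[OF xy] Q_lim[of 1 1]] by simp
    then have "S x y = U x y - q * x" using xy by (simp add: q_def field_simps)
    then show "((\<lambda>N. integral {0..N} (\<lambda>t. green_log x y t * g t)) \<longlongrightarrow> 2 * pi * Re (\<Phi> (Complex x y)) - q * x) at_top"
      using K_S(1)[OF xy] by (simp add: K_def U_def)
  qed
qed

section \<open>Monotonicity along the boundary by reflection\<close>

lemma has_integral_reflect_about:
  fixes h :: "real \<Rightarrow> real"
  assumes "(h has_integral i) {a..b}"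
  shows "((\<lambda>t. h (c - t)) has_integral i) {c - b..c - a}"
proof (cases "a \<le> b")
  case True
  have "((\<lambda>t. h (- 1 *\<^sub>R t + c)) has_integral (1 / \<bar>- 1\<bar> ^ DIM(real)) *\<^sub>R i)
      ((\<lambda>t. (1 / - 1) *\<^sub>R t + - ((1 / - 1) *\<^sub>R c)) ` cbox a b)"
    by (rule has_integral_affinity) (use assms in auto)
  moreover have "(\<lambda>t. (1 / - 1) *\<^sub>R t + - ((1 / - 1) *\<^sub>R c)) ` cbox a b = {c - b..c - a}"
    using image_affinity_atLeastAtMost[of "-1" c a b] True by (simp add: add.commute)
  ultimately show ?thesis by (simp add: algebra_simps)
next
  case False
  then show ?thesis using assms by simp
qed

lemma integral_inverse_sqrt_le:
  fixes a b x :: real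
  assumes ab: "a \<le> b"
  obtains I where "((\<lambda>t. 1 / sqrt \<bar>x - t\<bar>) has_integral I) {a..b}" "I \<le> 4 * sqrt (b - a)"
proof -
  define P where "P = (\<lambda>t. if t \<le> x then - 2 * sqrt (x - t) else 2 * sqrt (t - x))"
  have P: "P t = - 2 * sqrt (max 0 (x - t)) + 2 * sqrt (max 0 (t - x))" for t
    by (auto simp: P_def max_def)
  have "((\<lambda>t. 1 / sqrt \<bar>x - t\<bar>) has_integral (P b - P a)) {a..b}"
  proof (rule fundamental_theorem_of_calculus_interior_strong[of "{x}"])
    show "continuous_on {a..b} P" unfolding P by (intro continuous_intros)
    fix t assume "t \<in> {a<..<b} - {x}"
    then consider "t < x" | "x < t" by force
    then show "(P has_vector_derivative 1 / sqrt \<bar>x - t\<bar>) (at t)"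
    proof cases
      case 1
      have "((\<lambda>t. - 2 * sqrt (x - t)) has_real_derivative 1 / sqrt \<bar>x - t\<bar>) (at t)"
        using 1 by (auto intro!: derivative_eq_intros simp: field_simps)
      then show ?thesis unfolding has_real_derivative_iff_has_vector_derivative[symmetric]
        by (rule has_field_derivative_transform_within_open[of _ _ _ "{..<x}"]) (use 1 in \<open>auto simp: P_def\<close>)
    next
      case 2
      have "((\<lambda>t. 2 * sqrt (t - x)) has_real_derivative 1 / sqrt \<bar>x - t\<bar>) (at t)"
        using 2 by (auto intro!: derivative_eq_intros simp: field_simps)
      then show ?thesis unfolding has_real_derivative_iff_has_vector_derivative[symmetric]
        by (rule has_field_derivative_transform_within_open[of _ _ _ "{x<..}"]) (use 2 in \<open>auto simp: P_def\<close>)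
    qed
  qed (use ab in auto)
  moreover have "P b - P a \<le> 4 * sqrt (b - a)"
  proof -
    have nn: "sqrt (b - a) \<ge> 0" using ab by simp
    consider "x \<le> a" | "b \<le> x" "a < x" | "a < x" "x < b" by linarith
    then show ?thesis
    proof cases
      case 1
      then have "2 * sqrt (b - x) - 2 * sqrt (a - x) \<le> 4 * sqrt (b - a)"
        using sqrt_add_le_add_sqrt[of "b - a" "a - x"] ab nn by (simp del: real_sqrt_ge_0_iff)
      then show ?thesis using 1 ab by (simp add: P)
    next
      case 2
      then have "2 * sqrt (x - a) - 2 * sqrt (x - b) \<le> 4 * sqrt (b - a)"
        using sqrt_add_le_add_sqrt[of "b - a" "x - b"] ab nn by (simp del: real_sqrt_ge_0_iff)
      then show ?thesis using 2 ab by (simp add: P)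
    next
      case 3
      then have "sqrt (b - x) \<le> sqrt (b - a)" "sqrt (x - a) \<le> sqrt (b - a)" by simp_all
      then have "2 * sqrt (b - x) + 2 * sqrt (x - a) \<le> 4 * sqrt (b - a)" by linarith
      then show ?thesis using 3 by (simp add: P)
    qed
  qed
  ultimately show thesis by (rule that)
qed

lemma ln_add_square_diff_lower:
  fixes s x x' y N :: real
  assumes s: "0 \<le> s" "s \<le> N" and x: "0 < x" "x \<le> x'" and y: "0 < y" "y \<le> 1"
  shows "ln (1 + (x' - x) * (x' + x) / ((N + x)\<^sup>2 + 1)) \<le> ln ((s + x')\<^sup>2 + y\<^sup>2) - ln ((s + x)\<^sup>2 + y\<^sup>2)"
proof -
  have D: "(s + x)\<^sup>2 + y\<^sup>2 > 0" "(s + x')\<^sup>2 + y\<^sup>2 > 0" using y by (simp_all add: sum_squares_pos)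
  have "(s + x)\<^sup>2 + y\<^sup>2 \<le> (N + x)\<^sup>2 + 1"
    using s x y by (intro add_mono power_mono) (auto simp: power_le_one)
  then have "(x' - x) * (x' + x) / ((N + x)\<^sup>2 + 1) \<le> (x' - x) * (x' + x + 2 * s) / ((s + x)\<^sup>2 + y\<^sup>2)"
    using s x D by (intro frac_le mult_left_mono mult_nonneg_nonneg) auto
  also have "\<dots> = ((s + x')\<^sup>2 + y\<^sup>2) / ((s + x)\<^sup>2 + y\<^sup>2) - 1"
    using D by (simp add: field_simps power2_eq_square)
  finally have "1 + (x' - x) * (x' + x) / ((N + x)\<^sup>2 + 1) \<le> ((s + x')\<^sup>2 + y\<^sup>2) / ((s + x)\<^sup>2 + y\<^sup>2)" by simp
  moreover have "0 < 1 + (x' - x) * (x' + x) / ((N + x)\<^sup>2 + 1)"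
    using x by (intro add_pos_nonneg divide_nonneg_nonneg mult_nonneg_nonneg) auto
  ultimately have "ln (1 + (x' - x) * (x' + x) / ((N + x)\<^sup>2 + 1)) \<le> ln (((s + x')\<^sup>2 + y\<^sup>2) / ((s + x)\<^sup>2 + y\<^sup>2))"
    using D by (subst ln_le_cancel_iff) auto
  then show ?thesis using ln_divide_pos[OF D(2,1)] by simp
qed

lemma ln_add_square_mono: "\<bar>a\<bar> \<le> \<bar>b\<bar> \<Longrightarrow> y > 0 \<Longrightarrow> ln (a\<^sup>2 + y\<^sup>2) \<le> ln (b\<^sup>2 + (y::real)\<^sup>2)"
  by (subst ln_le_cancel_iff) (auto simp: sum_squares_pos abs_le_square_iff)

text \<open>In the difference of the potentials at \<open>2\<mu> - x\<close> and \<open>x\<close>, the source at \<open>2\<mu> - t\<close> has the weight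
  \<open>gain\<close> and the source at \<open>t\<close> has the weight \<open>- loss\<close>.\<close>

definition gain :: "real \<Rightarrow> real \<Rightarrow> real \<Rightarrow> real \<Rightarrow> real" where
  "gain \<mu> x y t = green_log (2 * \<mu> - x) y (2 * \<mu> - t) - green_log x y (2 * \<mu> - t)"

definition loss :: "real \<Rightarrow> real \<Rightarrow> real \<Rightarrow> real \<Rightarrow> real" where
  "loss \<mu> x y t = green_log x y t - green_log (2 * \<mu> - x) y t"

definition reflection_margin :: "real \<Rightarrow> real \<Rightarrow> real \<Rightarrow> real" where
  "reflection_margin \<mu> x N = ln (1 + (2 * \<mu> - x - x) * (2 * \<mu> - x + x) / ((N + x)\<^sup>2 + 1))"

lemma green_log_ln: "y > 0 \<Longrightarrow> green_log x y t = ln ((t + x)\<^sup>2 + y\<^sup>2) - ln ((t - x)\<^sup>2 + y\<^sup>2)"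
  by (simp add: green_log_def ln_div sum_squares_pos)

lemma gain_ln:
  assumes "y > 0"
  shows "gain \<mu> x y t = (ln ((2 * \<mu> - t + (2 * \<mu> - x))\<^sup>2 + y\<^sup>2) - ln ((2 * \<mu> - t + x)\<^sup>2 + y\<^sup>2))
     + (ln ((2 * \<mu> - x - t)\<^sup>2 + y\<^sup>2) - ln ((x - t)\<^sup>2 + y\<^sup>2))"
proof -
  have "2 * \<mu> - t - (2 * \<mu> - x) = x - t" "2 * \<mu> - t - x = 2 * \<mu> - x - t" by simp_all
  then show ?thesis using assms by (simp only: gain_def green_log_ln)
qed

lemma gain_minus_loss_ln:
  assumes "y > 0"
  shows "gain \<mu> x y t - loss \<mu> x y t
    = (ln ((2 * \<mu> - t + (2 * \<mu> - x))\<^sup>2 + y\<^sup>2) - ln ((2 * \<mu> - t + x)\<^sup>2 + y\<^sup>2))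
    + (ln ((t + (2 * \<mu> - x))\<^sup>2 + y\<^sup>2) - ln ((t + x)\<^sup>2 + y\<^sup>2))"
  unfolding gain_ln[OF assms] loss_def green_log_ln[OF assms]
  by (simp add: power2_commute[of t] power2_commute[of t "2 * \<mu> - x"])

lemma reflection_margin_pos: "0 < x \<Longrightarrow> x < \<mu> \<Longrightarrow> reflection_margin \<mu> x N > 0"
  unfolding reflection_margin_def
  by (intro ln_gt_zero) (auto intro!: divide_pos_pos add_nonneg_pos)

text \<open>The bounds must be uniform as \<open>y \<rightarrow> 0\<close>. By \<open>gain_ln\<close> and \<open>gain_minus_loss_ln\<close>,
  both quantities are sums of logarithms of quotients that are at least \<open>1\<close>, and one of these quotients is
  bounded away from \<open>1\<close>.\<close>

lemma reflection_bounds: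
  assumes x: "0 < x" "x < \<mu>" and t: "0 \<le> t" "t \<le> \<mu>" and y: "0 < y" "y \<le> 1" and N: "2 * \<mu> \<le> N"
  shows "reflection_margin \<mu> x N \<le> gain \<mu> x y t"
    and "reflection_margin \<mu> x N \<le> gain \<mu> x y t - loss \<mu> x y t"
proof -
  have 1: "reflection_margin \<mu> x N \<le> ln ((2 * \<mu> - t + (2 * \<mu> - x))\<^sup>2 + y\<^sup>2) - ln ((2 * \<mu> - t + x)\<^sup>2 + y\<^sup>2)"
    unfolding reflection_margin_def using x t y N by (intro ln_add_square_diff_lower) auto
  have "reflection_margin \<mu> x N \<le> ln ((t + (2 * \<mu> - x))\<^sup>2 + y\<^sup>2) - ln ((t + x)\<^sup>2 + y\<^sup>2)"
    unfolding reflection_margin_def using x t y N by (intro ln_add_square_diff_lower) auto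
  then show "reflection_margin \<mu> x N \<le> gain \<mu> x y t - loss \<mu> x y t"
    using 1 reflection_margin_pos[OF x, of N] by (simp only: gain_minus_loss_ln[OF y(1)])
  have "ln ((x - t)\<^sup>2 + y\<^sup>2) \<le> ln ((2 * \<mu> - x - t)\<^sup>2 + y\<^sup>2)"
    using x t y by (intro ln_add_square_mono) auto
  then show "reflection_margin \<mu> x N \<le> gain \<mu> x y t"
    using 1 by (simp only: gain_ln[OF y(1)])
qed

lemma reflection_tail_bound:
  assumes x: "0 < x" "x < \<mu>" and t: "2 * \<mu> \<le> t" "t \<le> N" and y: "0 < y" "y \<le> 1"
  shows "reflection_margin \<mu> x N \<le> green_log (2 * \<mu> - x) y t - green_log x y t"
proof -
  have "reflection_margin \<mu> x N \<le> ln ((t + (2 * \<mu> - x))\<^sup>2 + y\<^sup>2) - ln ((t + x)\<^sup>2 + y\<^sup>2)"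
    unfolding reflection_margin_def using x t y by (intro ln_add_square_diff_lower) auto
  moreover have "ln ((t - (2 * \<mu> - x))\<^sup>2 + y\<^sup>2) \<le> ln ((t - x)\<^sup>2 + y\<^sup>2)"
    using x t y by (intro ln_add_square_mono) auto
  ultimately show ?thesis using y by (simp add: green_log_ln)
qed

lemma reflection_tail_nonneg:
  assumes x: "0 < x" "x < \<mu>" and t: "2 * \<mu> \<le> t" and y: "0 < y"
  shows "0 \<le> green_log (2 * \<mu> - x) y t - green_log x y t"
proof -
  have "ln ((t + x)\<^sup>2 + y\<^sup>2) \<le> ln ((t + (2 * \<mu> - x))\<^sup>2 + y\<^sup>2)"
    "ln ((t - (2 * \<mu> - x))\<^sup>2 + y\<^sup>2) \<le> ln ((t - x)\<^sup>2 + y\<^sup>2)"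
    using x t y by (intro ln_add_square_mono; simp)+
  then show ?thesis using y by (simp add: green_log_ln)
qed

text \<open>The logarithmic singularity at \<open>t = x\<close> is weakened to an inverse square root, which has an explicit
  primitive.\<close>

lemma gain_le:
  assumes x: "0 < x" "x < \<mu>" and t: "0 \<le> t" "t \<le> \<mu>" "t \<noteq> x" and y: "0 < y"
  shows "gain \<mu> x y t \<le> 4 * sqrt (8 * \<mu>) * (1 / sqrt \<bar>x - t\<bar>)"
proof -
  have \<mu>: "\<mu> > 0" using x by simp
  define d where "d = \<bar>x - t\<bar>"
  have d: "d > 0" "d \<le> 2 * \<mu>" "(x - t)\<^sup>2 = d\<^sup>2" using t x by (auto simp: d_def)
  have "(2 * \<mu> - t + (2 * \<mu> - x))\<^sup>2 + y\<^sup>2 \<le> 4\<^sup>2 * ((2 * \<mu> - t + x)\<^sup>2 + y\<^sup>2)"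
  proof -
    define a b where "a = 2 * \<mu> - t + (2 * \<mu> - x)" and "b = 2 * \<mu> - t + x"
    have "a\<^sup>2 \<le> (4 * b)\<^sup>2" using x t by (intro power_mono) (auto simp: a_def b_def)
    then have "a\<^sup>2 \<le> 16 * b\<^sup>2" by (simp add: power_mult_distrib)
    then have "a\<^sup>2 + y\<^sup>2 \<le> 16 * b\<^sup>2 + 16 * y\<^sup>2" by (intro add_mono) auto
    then show ?thesis by (simp add: a_def b_def)
  qed
  then have "ln ((2 * \<mu> - t + (2 * \<mu> - x))\<^sup>2 + y\<^sup>2) \<le> ln (4\<^sup>2 * ((2 * \<mu> - t + x)\<^sup>2 + y\<^sup>2))"
    using y by (intro ln_mono) (auto simp: sum_squares_pos)
  also have "\<dots> = ln (4\<^sup>2) + ln ((2 * \<mu> - t + x)\<^sup>2 + y\<^sup>2)"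
    using y sum_squares_pos[of y "2 * \<mu> - t + x"] by (intro ln_mult_pos) auto
  finally have 1: "ln ((2 * \<mu> - t + (2 * \<mu> - x))\<^sup>2 + y\<^sup>2) - ln ((2 * \<mu> - t + x)\<^sup>2 + y\<^sup>2) \<le> ln (4\<^sup>2)" by simp
  have "d\<^sup>2 * ((2 * \<mu> - x - t)\<^sup>2 + y\<^sup>2) \<le> (2 * \<mu>)\<^sup>2 * ((x - t)\<^sup>2 + y\<^sup>2)"
  proof -
    have "(2 * \<mu> - x - t)\<^sup>2 \<le> (2 * \<mu>)\<^sup>2" using x t by (intro power_mono) auto
    then have "d\<^sup>2 * (2 * \<mu> - x - t)\<^sup>2 \<le> (2 * \<mu>)\<^sup>2 * (x - t)\<^sup>2" using d by (simp add: mult.commute mult_right_mono)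
    moreover have "d\<^sup>2 * y\<^sup>2 \<le> (2 * \<mu>)\<^sup>2 * y\<^sup>2" using d by (intro mult_right_mono power_mono) auto
    ultimately show ?thesis by (simp add: distrib_left)
  qed
  then have "ln (d\<^sup>2 * ((2 * \<mu> - x - t)\<^sup>2 + y\<^sup>2)) \<le> ln ((2 * \<mu>)\<^sup>2 * ((x - t)\<^sup>2 + y\<^sup>2))"
    using y d \<mu> by (intro ln_mono) (auto simp: sum_squares_pos)
  then have "ln (d\<^sup>2) + ln ((2 * \<mu> - x - t)\<^sup>2 + y\<^sup>2) \<le> ln ((2 * \<mu>)\<^sup>2) + ln ((x - t)\<^sup>2 + y\<^sup>2)"
    using y d(1) \<mu> sum_squares_pos[of y "2 * \<mu> - x - t"] sum_squares_pos[of y "x - t"]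
    by (simp add: ln_mult_pos)
  with 1 have "gain \<mu> x y t \<le> ln (4\<^sup>2) + ln ((2 * \<mu>)\<^sup>2) - ln (d\<^sup>2)"
    unfolding gain_ln[OF y] by linarith
  also have "\<dots> = 2 * (ln 4 + ln (2 * \<mu>) - ln d)"
    using \<mu> d(1) by (simp only: ln_realpow) simp
  also have "ln 4 + ln (2 * \<mu>) = ln (8 * \<mu>)"
    using ln_mult_pos[of 4 "2 * \<mu>"] \<mu> by simp
  also have "ln (8 * \<mu>) - ln d = 2 * ln (sqrt (8 * \<mu> / d))"
    using \<mu> d by (simp add: ln_sqrt ln_div)
  also have "ln (sqrt (8 * \<mu> / d)) \<le> sqrt (8 * \<mu> / d)"
    using \<mu> d ln_le_minus_one[of "sqrt (8 * \<mu> / d)"] by simp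
  finally show ?thesis by (simp add: d_def real_sqrt_divide)
qed

text \<open>The situation to which the method of moving planes is applied: \<open>v\<close> is the potential, up to a
  multiple of \<open>x\<close>, of the flux that its own boundary values \<open>\<phi>\<close> determine. The formula is required only
  for \<open>y > 0\<close>, where the kernel is continuous; statements about \<open>\<phi>\<close> are obtained as \<open>y \<rightarrow> 0\<close>.\<close>

locale boundary_potential =
  fixes f \<phi> :: "real \<Rightarrow> real" and v :: "real \<times> real \<Rightarrow> real" and q :: real
  assumes f_nonneg: "\<And>t. t \<ge> 0 \<Longrightarrow> f t \<ge> 0"
    and f_mono: "mono_on {0..} f"
    and f_cont: "continuous_on {0..} f"
    and f_lipschitz: "\<And>B. \<exists>L\<ge>0. \<forall>s\<in>{0..B}. \<forall>t\<in>{0..B}. \<bar>f t - f s\<bar> \<le> L * \<bar>t - s\<bar>"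
    and v_cont: "continuous_on ({0..} \<times> {0..}) v"
    and v_boundary: "\<And>x. x \<ge> 0 \<Longrightarrow> v (x, 0) = \<phi> x"
    and \<phi>_nonneg: "\<And>x. x \<ge> 0 \<Longrightarrow> \<phi> x \<ge> 0"
    and f_0: "f 0 = 0" and \<phi>_0: "\<phi> 0 = 0"
    and q_nonneg: "q \<ge> 0"
    and representation: "\<And>x y. x > 0 \<Longrightarrow> y > 0 \<Longrightarrow>
       ((\<lambda>N. integral {0..N} (\<lambda>t. green_log x y t * f (\<phi> t))) \<longlongrightarrow> 2 * pi * v (x, y) - q * x) at_top"
begin

abbreviation g :: "real \<Rightarrow> real" where "g t \<equiv> f (\<phi> t)"

lemma \<phi>_cont: "continuous_on {0..} \<phi>"
proof -
  have "continuous_on {0..} (\<lambda>x. v (x, 0))"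
    by (intro continuous_on_compose2[OF v_cont] continuous_intros) auto
  then show ?thesis by (rule continuous_on_eq) (simp add: v_boundary)
qed

lemma g_cont: "S \<subseteq> {0..} \<Longrightarrow> continuous_on S g"
  by (intro continuous_on_compose2[OF f_cont] continuous_on_subset[OF \<phi>_cont]) (auto simp: \<phi>_nonneg)

lemma g_nonneg: "t \<ge> 0 \<Longrightarrow> g t \<ge> 0"
  by (simp add: f_nonneg \<phi>_nonneg)

lemma g_mono: "0 \<le> s \<Longrightarrow> 0 \<le> t \<Longrightarrow> \<phi> s \<le> \<phi> t \<Longrightarrow> g s \<le> g t"
  by (rule mono_onD[OF f_mono]) (auto simp: \<phi>_nonneg)

lemma v_tendsto_boundary:
  assumes "x \<ge> 0"
  shows "((\<lambda>y. v (x, y)) \<longlongrightarrow> \<phi> x) (at_right 0)"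
proof -
  have "continuous_on {0..} (\<lambda>y. v (x, y))"
    using assms by (intro continuous_on_compose2[OF v_cont] continuous_intros) auto
  then have "((\<lambda>y. v (x, y)) \<longlongrightarrow> v (x, 0)) (at 0 within {0..})"
    by (simp add: continuous_on)
  then show ?thesis using assms by (simp add: v_boundary at_within_Ici_at_right)
qed

text \<open>The sources in \<open>[\<mu>, 2\<mu>]\<close> are paired with their reflections in \<open>[0, \<mu>]\<close>. Sources beyond \<open>2\<mu>\<close>
  are closer to \<open>2\<mu> - x\<close> than to \<open>x\<close>, so cutting them off at \<open>N\<close> only decreases the difference.\<close>

lemma reflected_difference:
  assumes x: "0 < x" "x < \<mu>" and y: "0 < y" and N: "2 * \<mu> \<le> N"
  shows "integral {0..\<mu>} (\<lambda>t. gain \<mu> x y t * g (2 * \<mu> - t) - loss \<mu> x y t * g t)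
       + integral {2 * \<mu>..N} (\<lambda>t. (green_log (2 * \<mu> - x) y t - green_log x y t) * g t)
       \<le> 2 * pi * (v (2 * \<mu> - x, y) - v (x, y))"
proof -
  define x' where "x' = 2 * \<mu> - x"
  have x': "x < x'" "0 < x'" using x by (auto simp: x'_def)
  define k where "k = (\<lambda>t. green_log x' y t - green_log x y t)"
  have kc: "continuous_on S k" for S unfolding k_def by (intro continuous_intros continuous_on_green_log y)
  have ki: "(\<lambda>t. k t * g t) integrable_on {a..b}" if "0 \<le> a" for a b
    using that by (intro integrable_continuous_interval continuous_intros kc g_cont) auto
  have refl: "integral {\<mu>..2 * \<mu>} (\<lambda>t. k t * g t) = integral {0..\<mu>} (\<lambda>t. k (2 * \<mu> - t) * g (2 * \<mu> - t))"
    using has_integral_reflect_about[OF integrable_integral[OF ki[of \<mu> "2 * \<mu>"]], of "2 * \<mu>"] x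
    by (simp add: integral_unique)
  have refl_int: "(\<lambda>t. k (2 * \<mu> - t) * g (2 * \<mu> - t)) integrable_on {0..\<mu>}"
    using has_integral_reflect_about[OF integrable_integral[OF ki[of \<mu> "2 * \<mu>"]], of "2 * \<mu>"] x
    by (auto simp: integrable_on_def)
  have fold: "integral {0..2 * \<mu>} (\<lambda>t. k t * g t)
      = integral {0..\<mu>} (\<lambda>t. gain \<mu> x y t * g (2 * \<mu> - t) - loss \<mu> x y t * g t)"
  proof -
    have "integral {0..2 * \<mu>} (\<lambda>t. k t * g t)
        = integral {0..\<mu>} (\<lambda>t. k t * g t) + integral {0..\<mu>} (\<lambda>t. k (2 * \<mu> - t) * g (2 * \<mu> - t))"
      using Henstock_Kurzweil_Integration.integral_combine[OF _ _ ki[of 0 "2 * \<mu>"], of \<mu>] x by (simp add: refl)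
    also have "\<dots> = integral {0..\<mu>} (\<lambda>t. k t * g t + k (2 * \<mu> - t) * g (2 * \<mu> - t))"
      by (rule Henstock_Kurzweil_Integration.integral_add[symmetric]) (use ki refl_int in auto)
    also have "(\<lambda>t. k t * g t + k (2 * \<mu> - t) * g (2 * \<mu> - t))
        = (\<lambda>t. gain \<mu> x y t * g (2 * \<mu> - t) - loss \<mu> x y t * g t)"
      by (simp add: k_def gain_def loss_def x'_def algebra_simps)
    finally show ?thesis .
  qed
  have "((\<lambda>M. integral {0..M} (\<lambda>t. green_log x' y t * g t) - integral {0..M} (\<lambda>t. green_log x y t * g t))
      \<longlongrightarrow> (2 * pi * v (x', y) - q * x') - (2 * pi * v (x, y) - q * x)) at_top"
    using x x' y by (intro tendsto_diff representation) auto
  moreover have "integral {0..M} (\<lambda>t. green_log x' y t * g t) - integral {0..M} (\<lambda>t. green_log x y t * g t)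
      = integral {0..M} (\<lambda>t. k t * g t)" for M
  proof -
    have i: "(\<lambda>t. green_log z y t * g t) integrable_on {0..M}" for z
      by (intro integrable_continuous_interval continuous_on_green_log_mult y g_cont) auto
    show ?thesis
      using Henstock_Kurzweil_Integration.integral_diff[OF i[of x'] i[of x]]
      by (simp add: k_def left_diff_distrib)
  qed
  ultimately have lim: "((\<lambda>M. integral {0..M} (\<lambda>t. k t * g t))
      \<longlongrightarrow> 2 * pi * (v (x', y) - v (x, y)) - q * (x' - x)) at_top"
    by (simp add: algebra_simps)
  have "\<forall>\<^sub>F M in at_top. integral {0..2 * \<mu>} (\<lambda>t. k t * g t) + integral {2 * \<mu>..N} (\<lambda>t. k t * g t)
      \<le> integral {0..M} (\<lambda>t. k t * g t)"
    using eventually_ge_at_top[of N]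
  proof eventually_elim
    case (elim M)
    have "integral {2 * \<mu>..N} (\<lambda>t. k t * g t) \<le> integral {2 * \<mu>..M} (\<lambda>t. k t * g t)"
    proof (rule integral_subset_le)
      show "\<forall>t\<in>{2 * \<mu>..M}. 0 \<le> k t * g t"
        using reflection_tail_nonneg[OF x _ y] x g_nonneg by (auto simp: k_def x'_def)
    qed (use ki x elim in auto)
    moreover have "integral {0..M} (\<lambda>t. k t * g t)
        = integral {0..2 * \<mu>} (\<lambda>t. k t * g t) + integral {2 * \<mu>..M} (\<lambda>t. k t * g t)"
      using Henstock_Kurzweil_Integration.integral_combine[OF _ _ ki[of 0 M], of "2 * \<mu>"] x N elim by simp
    ultimately show ?case by simp
  qed
  then have "integral {0..2 * \<mu>} (\<lambda>t. k t * g t) + integral {2 * \<mu>..N} (\<lambda>t. k t * g t)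
      \<le> 2 * pi * (v (x', y) - v (x, y)) - q * (x' - x)"
    by (rule tendsto_lowerbound[OF lim]) simp
  also have "\<dots> \<le> 2 * pi * (v (x', y) - v (x, y))" using q_nonneg x' by simp
  finally show ?thesis unfolding fold by (simp add: k_def x'_def)
qed

lemma tendsto_reflected_difference:
  assumes "0 \<le> x" "x \<le> \<mu>"
  shows "((\<lambda>y. 2 * pi * (v (2 * \<mu> - x, y) - v (x, y))) \<longlongrightarrow> 2 * pi * (\<phi> (2 * \<mu> - x) - \<phi> x)) (at_right 0)"
  using assms by (intro tendsto_intros v_tendsto_boundary) auto

lemma eventually_at_right_0_le_1: "\<forall>\<^sub>F y :: real in at_right 0. 0 < y \<and> y \<le> 1"
  unfolding eventually_at_right_field by (intro exI[of _ 1]) auto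

text \<open>The maximum principle for narrow intervals. Let \<open>- m < 0\<close> be the minimum of
  \<open>\<phi> (2 * \<mu> - t) - \<phi> t\<close>. Then \<open>2 * pi * m\<close> is at most \<open>L * m\<close> times the integral of \<open>gain\<close> over the set where this
  difference is negative. If the set is confined to short intervals at the ends of \<open>[0, \<mu>]\<close>, the
  integral is too small for that.\<close>

lemma narrow_reflection:
  assumes \<epsilon>: "0 < \<epsilon>" "\<epsilon> \<le> \<mu>"
    and B: "\<And>t. t \<in> {0..2 * \<mu>} \<Longrightarrow> \<phi> t \<le> B"
    and L: "L \<ge> 0" "\<And>s t. s \<in> {0..B} \<Longrightarrow> t \<in> {0..B} \<Longrightarrow> \<bar>f t - f s\<bar> \<le> L * \<bar>t - s\<bar>"
    and small: "32 * L * sqrt (8 * \<mu>) * sqrt \<epsilon> < 2 * pi"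
    and middle: "\<And>t. t \<in> {\<epsilon>..\<mu> - \<epsilon>} \<Longrightarrow> \<phi> t \<le> \<phi> (2 * \<mu> - t)"
    and t: "t \<in> {0..\<mu>}"
  shows "\<phi> t \<le> \<phi> (2 * \<mu> - t)"
proof -
  define w where "w = (\<lambda>t. \<phi> (2 * \<mu> - t) - \<phi> t)"
  have \<mu>: "\<mu> > 0" using \<epsilon> by simp
  have "continuous_on {0..\<mu>} w"
    unfolding w_def by (intro continuous_intros continuous_on_compose2[OF \<phi>_cont] continuous_on_subset[OF \<phi>_cont]) auto
  then obtain x where x: "x \<in> {0..\<mu>}" "\<And>t. t \<in> {0..\<mu>} \<Longrightarrow> w x \<le> w t"
    using continuous_attains_inf[of "{0..\<mu>}" w] \<mu> by auto
  have "w x \<ge> 0"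
  proof (rule ccontr)
    assume "\<not> w x \<ge> 0"
    define m where "m = - w x"
    have m: "m > 0" using \<open>\<not> w x \<ge> 0\<close> by (simp add: m_def)
    have "x \<noteq> 0" using m \<phi>_0 \<phi>_nonneg[of "2 * \<mu>"] \<mu> by (auto simp: m_def w_def)
    moreover have "x \<noteq> \<mu>" using m by (auto simp: m_def w_def)
    ultimately have x1: "0 < x" "x < \<mu>" using x by auto
    define c where "c = L * m * (4 * sqrt (8 * \<mu>))"
    have c: "c \<ge> 0" using L m \<mu> by (simp add: c_def)
    obtain I1 where I1: "((\<lambda>t. 1 / sqrt \<bar>x - t\<bar>) has_integral I1) {0..\<epsilon>}" "I1 \<le> 4 * sqrt \<epsilon>"
      using integral_inverse_sqrt_le[of 0 \<epsilon> x] \<epsilon> by auto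
    obtain I2 where I2: "((\<lambda>t. 1 / sqrt \<bar>x - t\<bar>) has_integral I2) {\<mu> - \<epsilon>..\<mu>}" "I2 \<le> 4 * sqrt \<epsilon>"
      using integral_inverse_sqrt_le[of "\<mu> - \<epsilon>" \<mu> x] \<epsilon> by auto
    define h where "h = (\<lambda>t. (if t \<in> {0..\<epsilon>} then 1 / sqrt \<bar>x - t\<bar> else 0)
        + (if t \<in> {\<mu> - \<epsilon>..\<mu>} then 1 / sqrt \<bar>x - t\<bar> else 0))"
    have h_int: "(h has_integral I1 + I2) {0..\<mu>}"
      unfolding h_def using \<epsilon>
      by (intro has_integral_add has_integral_restrict[THEN iffD2] I1(1) I2(1)) auto
    have bound: "- (c * (I1 + I2)) \<le> 2 * pi * (v (2 * \<mu> - x, y) - v (x, y))" if y: "0 < y" "y \<le> 1" for y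
    proof -
      define F where "F = (\<lambda>t. gain \<mu> x y t * g (2 * \<mu> - t) - loss \<mu> x y t * g t)"
      have "continuous_on {0..\<mu>} F"
        unfolding F_def gain_def loss_def
        by (intro continuous_intros continuous_on_compose2[OF continuous_on_green_log[of y UNIV]]
            continuous_on_compose2[OF g_cont[of "{0..}"]] continuous_on_green_log g_cont y) auto
      then have F_int: "(F has_integral integral {0..\<mu>} F) {0..\<mu>}"
        by (intro integrable_integral integrable_continuous_interval)
      \<comment> \<open>The bound on \<open>gain\<close> is not available at the singularity \<open>t = x\<close>, which is negligible.\<close>
      define H where "H = (\<lambda>t. if t = x then F x else - (c * h t))"
      have H_int: "(H has_integral - (c * (I1 + I2))) {0..\<mu>}"
        using has_integral_spike_finite[of "{x}" "{0..\<mu>}" H "\<lambda>t. - (c * h t)"]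
          has_integral_neg[OF has_integral_mult_right[OF h_int, of c]] by (auto simp: H_def)
      have "- (c * (I1 + I2)) \<le> integral {0..\<mu>} F"
      proof (rule has_integral_le[OF H_int F_int])
        fix t assume t: "t \<in> {0..\<mu>}"
        show "H t \<le> F t"
        proof (cases "t = x")
          case True
          then show ?thesis by (simp add: H_def)
        next
          case False
          note rb = reflection_bounds[OF x1 _ _ y order_refl, of t] reflection_margin_pos[OF x1, of "2 * \<mu>"]
          have gain: "0 \<le> gain \<mu> x y t" "loss \<mu> x y t \<le> gain \<mu> x y t" using rb t by auto
          have g0: "0 \<le> g t" using t by (simp add: g_nonneg)
          have "F t = gain \<mu> x y t * (g (2 * \<mu> - t) - g t) + (gain \<mu> x y t - loss \<mu> x y t) * g t"
            by (simp add: F_def algebra_simps)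
          then have F_ge: "gain \<mu> x y t * (g (2 * \<mu> - t) - g t) \<le> F t" using gain g0 by simp
          have h0: "0 \<le> h t" by (simp add: h_def)
          show ?thesis
          proof (cases "w t \<ge> 0")
            case True
            then have "g t \<le> g (2 * \<mu> - t)" using t by (intro g_mono) (auto simp: w_def)
            then have "0 \<le> F t" using F_ge gain by (meson diff_ge_0_iff_ge mult_nonneg_nonneg order_trans)
            moreover have "- (c * h t) \<le> 0" using c h0 by simp
            ultimately show ?thesis using False by (simp add: H_def)
          next
            case neg: False
            then have "t \<notin> {\<epsilon>..\<mu> - \<epsilon>}" using middle[of t] by (auto simp: w_def)
            then have h1: "1 / sqrt \<bar>x - t\<bar> \<le> h t" using t by (auto simp: h_def)
            have "g t - g (2 * \<mu> - t) \<le> L * \<bar>\<phi> t - \<phi> (2 * \<mu> - t)\<bar>"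
              using L(2)[of "\<phi> (2 * \<mu> - t)" "\<phi> t"] t B[of t] B[of "2 * \<mu> - t"] \<phi>_nonneg[of t] \<phi>_nonneg[of "2 * \<mu> - t"]
              by auto
            also have "\<dots> \<le> L * m"
              using x(2)[OF t] neg L(1) by (intro mult_left_mono) (auto simp: w_def m_def)
            finally have "- (L * m) \<le> g (2 * \<mu> - t) - g t" by simp
            then have "gain \<mu> x y t * - (L * m) \<le> F t"
              using F_ge mult_left_mono[OF _ gain(1)] by (meson order_trans)
            moreover have "gain \<mu> x y t \<le> 4 * sqrt (8 * \<mu>) * h t"
              using gain_le[OF x1 _ _ False y(1)] t h1 mult_left_mono[OF h1, of "4 * sqrt (8 * \<mu>)"] \<mu> by auto
            then have "gain \<mu> x y t * (L * m) \<le> c * h t"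
              using mult_right_mono[of "gain \<mu> x y t" "4 * sqrt (8 * \<mu>) * h t" "L * m"] L m
              by (simp add: c_def mult_ac)
            ultimately show ?thesis using False by (simp add: H_def)
          qed
        qed
      qed
      also have "\<dots> \<le> 2 * pi * (v (2 * \<mu> - x, y) - v (x, y))"
        using reflected_difference[OF x1 y(1) order_refl] by (simp add: F_def)
      finally show ?thesis .
    qed
    have "- (c * (I1 + I2)) \<le> 2 * pi * (\<phi> (2 * \<mu> - x) - \<phi> x)"
      by (rule tendsto_lowerbound[OF tendsto_reflected_difference])
        (use x eventually_at_right_0_le_1 bound in \<open>auto elim!: eventually_mono\<close>)
    also have "\<dots> = - (2 * pi * m)" by (simp add: m_def w_def algebra_simps)
    finally have "2 * pi * m \<le> c * (I1 + I2)" by simp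
    also have "\<dots> \<le> c * (8 * sqrt \<epsilon>)" using c I1 I2 by (intro mult_left_mono) auto
    also have "\<dots> = 32 * L * sqrt (8 * \<mu>) * sqrt \<epsilon> * m" by (simp add: c_def)
    also have "\<dots> < 2 * pi * m" using small m by (rule mult_strict_right_mono)
    finally show False by simp
  qed
  then show ?thesis using x(2)[OF t] by (simp add: w_def)
qed

text \<open>The integral of the flux is positive, so the margin makes the inequality strict in the limit
  \<open>y \<rightarrow> 0\<close>.\<close>

lemma strict_reflection:
  assumes t0: "0 < t0" "0 < g t0"
    and refl: "\<And>t. t \<in> {0..\<mu>} \<Longrightarrow> \<phi> t \<le> \<phi> (2 * \<mu> - t)"
    and x: "0 < x" "x < \<mu>"
  shows "\<phi> x < \<phi> (2 * \<mu> - x)"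
proof -
  obtain t1 where t1: "\<mu> \<le> t1" "0 < g t1"
  proof (cases "\<mu> \<le> t0")
    case True
    then show thesis using t0 that by blast
  next
    case False
    then have "g t0 \<le> g (2 * \<mu> - t0)" using t0 refl[of t0] by (intro g_mono) auto
    then show thesis using that[of "2 * \<mu> - t0"] False t0 by simp
  qed
  define N where "N = max (2 * \<mu>) t1"
  have N: "2 * \<mu> \<le> N" "t1 \<le> N" "\<mu> < N" using x by (auto simp: N_def)
  have gi: "g integrable_on {a..b}" if "0 \<le> a" for a b
    using that by (intro integrable_continuous_interval g_cont) auto
  define G where "G = integral {\<mu>..N} g"
  have "G \<noteq> 0"
    unfolding G_def using integral_eq_0_iff[OF g_cont[of "{\<mu>..N}"] N(3)] g_nonneg x t1 N by fastforce
  moreover have "G \<ge> 0" unfolding G_def using x gi g_nonneg by (intro integral_nonneg) auto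
  ultimately have G: "G > 0" by simp
  define c where "c = reflection_margin \<mu> x N"
  have c: "c > 0" unfolding c_def by (rule reflection_margin_pos[OF x])
  have "G = integral {\<mu>..2 * \<mu>} g + integral {2 * \<mu>..N} g"
    unfolding G_def using Henstock_Kurzweil_Integration.integral_combine[OF _ _ gi[of \<mu> N], of "2 * \<mu>"] x N by simp
  also have "integral {\<mu>..2 * \<mu>} g = integral {0..\<mu>} (\<lambda>t. g (2 * \<mu> - t))"
    using has_integral_reflect_about[OF integrable_integral[OF gi[of \<mu> "2 * \<mu>"]], of "2 * \<mu>"] x
    by (simp add: integral_unique)
  finally have G_eq: "G = integral {0..\<mu>} (\<lambda>t. g (2 * \<mu> - t)) + integral {2 * \<mu>..N} g" .
  have bound: "c * G \<le> 2 * pi * (v (2 * \<mu> - x, y) - v (x, y))" if y: "0 < y" "y \<le> 1" for y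
  proof -
    have "c * integral {0..\<mu>} (\<lambda>t. g (2 * \<mu> - t)) = integral {0..\<mu>} (\<lambda>t. c * g (2 * \<mu> - t))" by simp
    also have "\<dots> \<le> integral {0..\<mu>} (\<lambda>t. gain \<mu> x y t * g (2 * \<mu> - t) - loss \<mu> x y t * g t)"
    proof (rule integral_le)
      show "(\<lambda>t. c * g (2 * \<mu> - t)) integrable_on {0..\<mu>}"
        by (intro integrable_continuous_interval continuous_intros continuous_on_compose2[OF g_cont[of "{0..}"]]) auto
      show "(\<lambda>t. gain \<mu> x y t * g (2 * \<mu> - t) - loss \<mu> x y t * g t) integrable_on {0..\<mu>}"
        unfolding gain_def loss_def
        by (intro integrable_continuous_interval continuous_intros continuous_on_compose2[OF continuous_on_green_log[of y UNIV]]
            continuous_on_compose2[OF g_cont[of "{0..}"]] continuous_on_green_log g_cont y) auto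
      fix t assume t: "t \<in> {0..\<mu>}"
      have rb: "c \<le> gain \<mu> x y t" "c \<le> gain \<mu> x y t - loss \<mu> x y t"
        using reflection_bounds[OF x _ _ y N(1), of t] t by (auto simp: c_def)
      have gg: "0 \<le> g t" "g t \<le> g (2 * \<mu> - t)" using t refl[OF t] by (auto intro!: g_nonneg g_mono)
      have "0 \<le> (gain \<mu> x y t - c) * (g (2 * \<mu> - t) - g t) + (gain \<mu> x y t - loss \<mu> x y t - c) * g t"
        using rb gg by (intro add_nonneg_nonneg mult_nonneg_nonneg) auto
      then show "c * g (2 * \<mu> - t) \<le> gain \<mu> x y t * g (2 * \<mu> - t) - loss \<mu> x y t * g t"
        by (simp add: algebra_simps)
    qed
    finally have 1: "c * integral {0..\<mu>} (\<lambda>t. g (2 * \<mu> - t))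
        \<le> integral {0..\<mu>} (\<lambda>t. gain \<mu> x y t * g (2 * \<mu> - t) - loss \<mu> x y t * g t)" .
    have "c * integral {2 * \<mu>..N} g = integral {2 * \<mu>..N} (\<lambda>t. c * g t)" by simp
    also have "\<dots> \<le> integral {2 * \<mu>..N} (\<lambda>t. (green_log (2 * \<mu> - x) y t - green_log x y t) * g t)"
    proof (rule integral_le)
      show "(\<lambda>t. c * g t) integrable_on {2 * \<mu>..N}"
        using x by (intro integrable_continuous_interval continuous_intros g_cont) auto
      show "(\<lambda>t. (green_log (2 * \<mu> - x) y t - green_log x y t) * g t) integrable_on {2 * \<mu>..N}"
        using x by (intro integrable_continuous_interval continuous_intros continuous_on_green_log g_cont y) auto
      show "c * g t \<le> (green_log (2 * \<mu> - x) y t - green_log x y t) * g t" if "t \<in> {2 * \<mu>..N}" for t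
        using reflection_tail_bound[OF x _ _ y, of t N] that x g_nonneg[of t]
        by (intro mult_right_mono) (auto simp: c_def)
    qed
    finally show ?thesis
      using 1 reflected_difference[OF x y(1) N(1)] by (simp add: G_eq distrib_left)
  qed
  have "c * G \<le> 2 * pi * (\<phi> (2 * \<mu> - x) - \<phi> x)"
    by (rule tendsto_lowerbound[OF tendsto_reflected_difference])
      (use x eventually_at_right_0_le_1 bound in \<open>auto elim!: eventually_mono\<close>)
  moreover have "c * G > 0" using c G by simp
  ultimately have "0 < 2 * pi * (\<phi> (2 * \<mu> - x) - \<phi> x)" by linarith
  then show ?thesis by (simp add: zero_less_mult_iff)
qed

text \<open>The method of moving planes: the reflection inequality holds for small \<open>\<mu>\<close> by the narrow
  maximum principle, persists under limits, and, being strict, extends beyond any value of \<open>\<mu>\<close>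
  because it can fail only near the ends of the interval.\<close>

lemma reflection_inequality:
  assumes t0: "0 < t0" "0 < g t0" and M: "0 < M"
  shows "\<forall>t\<in>{0..M}. \<phi> t \<le> \<phi> (2 * M - t)"
proof -
  define P where "P = (\<lambda>\<mu>. \<forall>t\<in>{0..\<mu>}. \<phi> t \<le> \<phi> (2 * \<mu> - t))"
  have cont2: "continuous_on {0..2 * M} \<phi>" by (rule continuous_on_subset[OF \<phi>_cont]) auto
  then have "bounded (\<phi> ` {0..2 * M})" by (intro compact_imp_bounded compact_continuous_image) auto
  then obtain B where B: "\<And>t. t \<in> {0..2 * M} \<Longrightarrow> \<phi> t \<le> B"
    unfolding bounded_iff by (metis abs_le_D1 imageI real_norm_def)
  obtain L where L: "L \<ge> 0" "\<And>s t. s \<in> {0..B} \<Longrightarrow> t \<in> {0..B} \<Longrightarrow> \<bar>f t - f s\<bar> \<le> L * \<bar>t - s\<bar>"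
    using f_lipschitz[of B] by blast
  define K where "K = 32 * L * sqrt (8 * M)"
  have K: "K \<ge> 0" using L M by (simp add: K_def)
  \<comment> \<open>Chosen such that \<open>K * sqrt e < 1\<close>, also if \<open>K = 0\<close>.\<close>
  define e where "e = (1 / (K + 1))\<^sup>2"
  have e: "e > 0" "sqrt e = 1 / (K + 1)" using K by (simp_all add: e_def)
  have narrow: "P \<mu>" if \<mu>: "\<mu> \<le> M" "0 < \<epsilon>" "\<epsilon> \<le> \<mu>" "\<epsilon> \<le> e"
    and mid: "\<And>t. t \<in> {\<epsilon>..\<mu> - \<epsilon>} \<Longrightarrow> \<phi> t \<le> \<phi> (2 * \<mu> - t)" for \<mu> \<epsilon>
  proof -
    have "32 * L * sqrt (8 * \<mu>) * sqrt \<epsilon> \<le> K * sqrt e"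
      unfolding K_def using \<mu> L by (intro mult_mono mult_nonneg_nonneg) auto
    also have "\<dots> < 1" unfolding e(2) using K by (simp add: field_simps)
    also have "1 < 2 * pi" using pi_gt3 by simp
    finally have "32 * L * sqrt (8 * \<mu>) * sqrt \<epsilon> < 2 * pi" .
    then show ?thesis unfolding P_def
      using narrow_reflection[of \<epsilon> \<mu> B L] \<mu> B L mid by auto
  qed
  define S where "S = {\<mu>. 0 < \<mu> \<and> \<mu> \<le> M \<and> (\<forall>\<nu>. 0 < \<nu> \<and> \<nu> \<le> \<mu> \<longrightarrow> P \<nu>)}"
  have bdd: "bdd_above S" by (auto simp: S_def intro!: bdd_aboveI[of _ M])
  have "P \<nu>" if "0 < \<nu>" "\<nu> \<le> min e M" for \<nu>
    using that by (intro narrow[of \<nu> \<nu>]) auto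
  then have start: "min e M \<in> S" using e M by (auto simp: S_def)
  define s where "s = Sup S"
  have s_ge: "\<mu> \<le> s" if "\<mu> \<in> S" for \<mu> unfolding s_def by (rule cSup_upper[OF that bdd])
  have "s \<le> M" unfolding s_def by (rule cSup_least) (use start in \<open>auto simp only: S_def\<close>)
  then have s: "0 < s" "s \<le> M" using s_ge[OF start] e(1) M by (auto simp: min_def split: if_splits)
  have below: "P \<nu>" if \<nu>: "0 < \<nu>" "\<nu> < s" for \<nu>
  proof -
    have "S \<noteq> {}" using start by blast
    then obtain \<mu> where "\<mu> \<in> S" "\<nu> < \<mu>" using less_cSup_iff[OF _ bdd] \<nu>(2) by (auto simp: s_def)
    then show ?thesis using \<nu>(1) by (auto simp: S_def)
  qed
  have "P s"
    unfolding P_def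
  proof
    fix t assume t: "t \<in> {0..s}"
    show "\<phi> t \<le> \<phi> (2 * s - t)"
    proof (cases "t = s")
      case False
      then have ts: "0 \<le> t" "t < s" using t by auto
      have "continuous_on {t..s} (\<lambda>\<nu>. \<phi> (2 * \<nu> - t))"
        using ts by (intro continuous_on_compose2[OF \<phi>_cont] continuous_intros) auto
      then have "((\<lambda>\<nu>. \<phi> (2 * \<nu> - t)) \<longlongrightarrow> \<phi> (2 * s - t)) (at s within {t..s})"
        using ts by (simp add: continuous_on)
      then have lim: "((\<lambda>\<nu>. \<phi> (2 * \<nu> - t)) \<longlongrightarrow> \<phi> (2 * s - t)) (at_left s)"
        using ts by (simp add: at_within_Icc_at_left)
      show ?thesis
      proof (rule tendsto_lowerbound[OF lim])
        show "\<forall>\<^sub>F \<nu> in at_left s. \<phi> t \<le> \<phi> (2 * \<nu> - t)"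
          unfolding eventually_at_left_field
          using ts below by (intro exI[of _ t]) (auto simp: P_def)
      qed simp
    qed simp
  qed
  have "s = M"
  proof (rule ccontr)
    assume "s \<noteq> M"
    then have "s < M" using s by simp
    define \<epsilon> where "\<epsilon> = min e s / 2"
    have \<epsilon>: "0 < \<epsilon>" "\<epsilon> \<le> e" "\<epsilon> \<le> s / 2" using e s by (auto simp: \<epsilon>_def)
    define w where "w = (\<lambda>t. \<phi> (2 * s - t) - \<phi> t)"
    have "continuous_on {\<epsilon> / 2..s - \<epsilon> / 2} w"
      unfolding w_def using \<epsilon>
      by (intro continuous_intros continuous_on_compose2[OF \<phi>_cont] continuous_on_subset[OF \<phi>_cont]) auto
    then obtain x where x: "x \<in> {\<epsilon> / 2..s - \<epsilon> / 2}" "\<And>t. t \<in> {\<epsilon> / 2..s - \<epsilon> / 2} \<Longrightarrow> w x \<le> w t"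
      using continuous_attains_inf[of "{\<epsilon> / 2..s - \<epsilon> / 2}" w] \<epsilon> by auto
    have wx: "w x > 0"
      using strict_reflection[OF t0, of s x] \<open>P s\<close> x(1) \<epsilon> by (auto simp: P_def w_def)
    have "uniformly_continuous_on {0..2 * M} \<phi>"
      by (rule compact_uniformly_continuous[OF cont2]) simp
    then obtain \<eta> where \<eta>: "\<eta> > 0"
      "\<And>a b. a \<in> {0..2 * M} \<Longrightarrow> b \<in> {0..2 * M} \<Longrightarrow> dist b a < \<eta> \<Longrightarrow> dist (\<phi> b) (\<phi> a) < w x"
      using wx unfolding uniformly_continuous_on_def by metis
    define \<mu> where "\<mu> = min M (s + min (\<eta> / 4) (\<epsilon> / 2))"
    have \<mu>: "s < \<mu>" "\<mu> \<le> M" using \<open>s < M\<close> \<eta>(1) \<epsilon>(1) by (auto simp: \<mu>_def)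
    have "P \<nu>" if \<nu>: "0 < \<nu>" "\<nu> \<le> \<mu>" for \<nu>
    proof (cases "\<nu> \<le> s")
      case True
      then show ?thesis using below[of \<nu>] \<nu> \<open>P s\<close> by (cases "\<nu> = s") auto
    next
      case False
      have close: "\<nu> - s \<le> \<eta> / 4" "\<nu> - s \<le> \<epsilon> / 2" "\<nu> \<le> M" using \<nu> by (auto simp: \<mu>_def)
      show ?thesis
      proof (rule narrow[of \<nu> \<epsilon>])
        fix t assume t: "t \<in> {\<epsilon>..\<nu> - \<epsilon>}"
        have t': "t \<in> {\<epsilon> / 2..s - \<epsilon> / 2}" using t close \<epsilon> by auto
        have "dist (2 * \<nu> - t) (2 * s - t) < \<eta>" using close False \<eta>(1) by (simp add: dist_real_def)
        moreover have "2 * \<nu> - t \<in> {0..2 * M}" "2 * s - t \<in> {0..2 * M}" using t t' close \<epsilon> s by auto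
        ultimately have "dist (\<phi> (2 * \<nu> - t)) (\<phi> (2 * s - t)) < w x" using \<eta>(2) by blast
        then show "\<phi> t \<le> \<phi> (2 * \<nu> - t)" using x(2)[OF t'] by (simp add: dist_real_def w_def)
      qed (use close \<epsilon> False s in auto)
    qed
    then have "\<mu> \<in> S" using \<mu> s by (auto simp: S_def)
    then show False using s_ge[of \<mu>] \<mu> by simp
  qed
  then show ?thesis using \<open>P s\<close> by (simp add: P_def)
qed

lemma \<phi>_mono:
  assumes t0: "0 < t0" "0 < g t0" and ab: "0 \<le> a" "a \<le> b"
  shows "\<phi> a \<le> \<phi> b"
proof (cases "b = 0")
  case False
  have "\<phi> a \<le> \<phi> (2 * ((a + b) / 2) - a)"
    using reflection_inequality[OF t0, of "(a + b) / 2"] ab False by auto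
  moreover have "2 * ((a + b) / 2) - a = b" by (simp add: field_simps)
  ultimately show ?thesis by simp
qed (use ab in auto)

text \<open>A positive flux, being nondecreasing, is bounded below near infinity, where the kernel decays
  only like \<open>1 / t\<close>; its potential would be infinite.\<close>

lemma flux_zero:
  assumes "t \<ge> 0"
  shows "g t = 0"
proof (rule ccontr)
  assume "g t \<noteq> 0"
  then have "t \<noteq> 0" using f_0 \<phi>_0 by auto
  then have t: "0 < t" "0 < g t" using \<open>g t \<noteq> 0\<close> g_nonneg[of t] assms by auto
  define a where "a = max t 1"
  \<comment> \<open>For \<open>s \<ge> 1\<close>, the inequality \<open>ln r \<ge> 1 - 1 / r\<close> yields \<open>green_log 1 1 s \<ge> 4 / (5 * s)\<close>.\<close>
  define c where "c = 4 / 5 * g t"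
  have c: "c > 0" using t by (simp add: c_def)
  have low: "c * (1 / s) \<le> green_log 1 1 s * g s" if s: "a \<le> s" for s
  proof -
    have s1: "1 \<le> s" "t \<le> s" using s by (auto simp: a_def)
    define r where "r = ((s + 1)\<^sup>2 + 1) / ((s - 1)\<^sup>2 + 1)"
    have pos: "(s + 1)\<^sup>2 + 1 > 0" "(s - 1)\<^sup>2 + 1 > 0" by (simp_all add: add_nonneg_pos)
    have r: "r > 0" using pos by (simp add: r_def)
    have "1 * 1 \<le> s * s" "1 * s \<le> s * s" using s1 by (intro mult_mono; simp)+
    then have "(s + 1)\<^sup>2 + 1 \<le> 5 * s\<^sup>2" by (simp add: power2_eq_square algebra_simps)
    then have "4 * s / (5 * s\<^sup>2) \<le> 4 * s / ((s + 1)\<^sup>2 + 1)" using s1 pos by (intro frac_le) auto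
    moreover have "4 / 5 * (1 / s) = 4 * s / (5 * s\<^sup>2)" using s1 by (simp add: power2_eq_square)
    ultimately have "4 / 5 * (1 / s) \<le> 4 * s / ((s + 1)\<^sup>2 + 1)" by simp
    also have "\<dots> = 1 - 1 / r"
      unfolding r_def using pos by (simp add: field_simps power2_eq_square)
    also have "\<dots> \<le> ln r"
      using ln_le_minus_one[of "1 / r"] r by (simp add: ln_div)
    finally have "4 / 5 * (1 / s) \<le> green_log 1 1 s" by (simp add: r_def green_log_def)
    moreover have "g t \<le> g s"
      using \<phi>_mono[OF t, of t s] s1 t by (intro g_mono) auto
    ultimately have "4 / 5 * (1 / s) * g t \<le> green_log 1 1 s * g s"
      using t s1 by (intro mult_mono) (auto intro: order_trans[rotated])
    then show ?thesis by (simp add: c_def mult_ac)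
  qed
  define l where "l = 2 * pi * v (1, 1) - q * 1"
  have gi: "(\<lambda>s. green_log 1 1 s * g s) integrable_on {b..N}" if "0 \<le> b" for b N
    using that by (intro integrable_continuous_interval continuous_on_green_log_mult g_cont) auto
  have "\<forall>\<^sub>F N in at_top. integral {0..N} (\<lambda>s. green_log 1 1 s * g s) < l + 1"
    using order_tendstoD(2)[OF representation[of 1 1], of "l + 1"] by (simp add: l_def)
  moreover have "filterlim (\<lambda>N. c * (ln N - ln a)) at_top at_top" using c by real_asymp
  then have "\<forall>\<^sub>F N in at_top. l + 1 < c * (ln N - ln a)" by (simp add: filterlim_at_top_dense)
  moreover have "\<forall>\<^sub>F N in at_top. a \<le> N" by (rule eventually_ge_at_top)
  ultimately have "\<forall>\<^sub>F N :: real in at_top. False"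
  proof eventually_elim
    case (elim N)
    have a1: "a \<ge> 1" by (simp add: a_def)
    have "((\<lambda>s. 1 / s) has_integral (ln N - ln a)) {a..N}"
      using elim a1 by (intro fundamental_theorem_of_calculus)
        (auto intro!: derivative_eq_intros simp flip: has_real_derivative_iff_has_vector_derivative)
    from has_integral_mult_right[OF this, of c]
    have "((\<lambda>s. c * (1 / s)) has_integral (c * (ln N - ln a))) {a..N}" .
    then have "c * (ln N - ln a) \<le> integral {a..N} (\<lambda>s. green_log 1 1 s * g s)"
      by (rule has_integral_le[OF _ integrable_integral[OF gi]]) (use low a1 in auto)
    also have "\<dots> \<le> integral {0..N} (\<lambda>s. green_log 1 1 s * g s)"
      by (rule integral_subset_le) (use gi a1 green_log_nonneg g_nonneg in auto)
    finally show ?case using elim by simp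
  qed
  then show False by simp
qed

lemma v_linear:
  assumes "x > 0" "y > 0"
  shows "v (x, y) = q / (2 * pi) * x"
proof -
  have "((\<lambda>N::real. 0) \<longlongrightarrow> 2 * pi * v (x, y) - q * x) at_top"
  proof (rule Lim_transform_eventually[OF representation[OF assms]])
    show "\<forall>\<^sub>F N in at_top. integral {0..N} (\<lambda>t. green_log x y t * g t) = 0"
      by (intro always_eventually allI) (auto simp: flux_zero intro!: integral_unique has_integral_is_0)
  qed
  then have "2 * pi * v (x, y) - q * x = 0"
    using tendsto_unique[OF _ _ tendsto_const] by force
  then show ?thesis by (simp add: field_simps)
qed

end

section \<open>Classical solutions\<close>

lemma C1_half_line_lipschitz:
  assumes "C1_half_line f"
  shows "continuous_on {0..} f"
    and "\<exists>L\<ge>0. \<forall>s\<in>{0..B}. \<forall>t\<in>{0..B}. \<bar>f t - f s\<bar> \<le> L * \<bar>t - s\<bar>"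
proof -
  obtain f' where f': "\<And>t. t \<ge> 0 \<Longrightarrow> (f has_real_derivative f' t) (at t within {0..})" "continuous_on {0..} f'"
    using assms by (auto simp: C1_half_line_def)
  show "continuous_on {0..} f" by (rule DERIV_continuous_on) (use f' in auto)
  have "bounded (f' ` {0..B})"
    by (intro compact_imp_bounded compact_continuous_image continuous_on_subset[OF f'(2)]) auto
  then obtain L where L: "L > 0" "\<And>t. t \<in> {0..B} \<Longrightarrow> norm (f' t) \<le> L"
    unfolding bounded_pos by blast
  have "norm (f t - f s) \<le> L * norm (t - s)" if "s \<in> {0..B}" "t \<in> {0..B}" for s t
    by (rule field_differentiable_bound[of "{0..B}" f f'])
      (use that L in \<open>auto intro!: DERIV_subset[OF f'(1)]\<close>)
  then show "\<exists>L\<ge>0. \<forall>s\<in>{0..B}. \<forall>t\<in>{0..B}. \<bar>f t - f s\<bar> \<le> L * \<bar>t - s\<bar>"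
    using L(1) by (intro exI[of _ L]) auto
qed

theorem theorem4p2:
  fixes f :: "real \<Rightarrow> real" and u :: "real \<times> real \<Rightarrow> real"
  assumes "\<And>t. t \<ge> 0 \<Longrightarrow> f t \<ge> 0"
    and "mono_on {0..} f"
    and "C1_half_line f"
    and "f 0 = 0"
    and "nonneg_classical_solution f u"
  shows "\<exists>C\<ge>0. \<forall>(x, y)\<in>quarter_plane. u (x, y) = C * x"
proof -
  from assms(5) have u1: "C1_on_closure quarter_plane u"
    and pos: "\<And>p. p \<in> quarter_plane \<Longrightarrow> u p \<ge> 0"
    and bdry: "\<And>y. y \<ge> 0 \<Longrightarrow> u (0, y) = 0"
    by (auto simp: nonneg_classical_solution_def)
  have u_cont: "continuous_on ({0..} \<times> {0..}) u"
    using u1 unfolding C1_on_closure_def closure_quarter_plane by blast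
  have u_nonneg: "u p \<ge> 0" if "p \<in> {0..} \<times> {0..}" for p
    by (rule continuous_ge_on_closure[of quarter_plane])
      (use u_cont that pos in \<open>auto simp: closure_quarter_plane\<close>)
  obtain \<Phi> where cont: "continuous_on closed_quadrant \<Phi>" and hol: "\<Phi> holomorphic_on open_quadrant"
    and \<Phi>0: "\<Phi> 0 = 0"
    and Re\<Phi>: "\<And>z. z \<in> closed_quadrant \<Longrightarrow> Re (\<Phi> z) = u (Re z, Im z)"
    and der: "\<And>t. t > 0 \<Longrightarrow> ((\<lambda>t. Im (\<Phi> (of_real t))) has_real_derivative f (u (t, 0))) (at t)"
    by (rule holomorphic_completion[OF assms(5)]) (rule that)
  note f_reg = C1_half_line_lipschitz[OF assms(3)]
  have flux_cont: "continuous_on {0..} (\<lambda>t. f (u (t, 0)))"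
    by (intro continuous_on_compose2[OF f_reg(1)] continuous_on_compose2[OF u_cont] continuous_intros)
      (auto simp: u_nonneg)
  have Re_nonneg: "Re (\<Phi> z) \<ge> 0" if "z \<in> closed_quadrant" for z
    using Re\<Phi>[OF that] u_nonneg that by simp
  have Re_imag: "Re (\<Phi> (\<i> * of_real y)) = 0" if "y \<ge> 0" for y
    using Re\<Phi>[of "\<i> * of_real y"] bdry that by simp
  have flux_nonneg: "f (u (t, 0)) \<ge> 0" if "t \<ge> 0" for t
    using assms(1) u_nonneg that by simp
  obtain q where q: "q \<ge> 0"
    "\<And>x y. x > 0 \<Longrightarrow> y > 0 \<Longrightarrow>
       ((\<lambda>N. integral {0..N} (\<lambda>t. green_log x y t * f (u (t, 0)))) \<longlongrightarrow> 2 * pi * Re (\<Phi> (Complex x y)) - q * x) at_top"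
    by (rule green_representation[OF cont hol \<Phi>0])
      (rule Re_nonneg Re_imag flux_cont flux_nonneg der that; assumption)+
  interpret boundary_potential f "\<lambda>x. u (x, 0)" u q
    by unfold_locales (use assms f_reg u_cont u_nonneg bdry q Re\<Phi> in auto)
  show ?thesis
    using q(1) v_linear by (intro exI[of _ "q / (2 * pi)"]) (auto simp: quarter_plane_def)
qed

end
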